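(* Let $\tau,\lambda\in(0,1]$ with $\tau+\lambda>1$, let $a<b$ be real numbers, and let $F_1,\dots,F_n$ be jointly Hölder continuous real-valued functions on $[a,b]^2$; more precisely, for each $i=1,\dots,n$ there is a finite constant $\|F_i\|_{\tau,\lambda;a,b}$ such that $$|F_i(s_1,t_1)-F_i(s_2,t_1)-F_i(s_1,t_2)+F_i(s_2,t_2)|\le\|F_i\|_{\tau,\lambda;a,b}\,|s_1-s_2|^\tau|t_1-t_2|^\lambda\quad\text{for all } s_1,s_2,t_1,t_2\in[a,b].$$ Let $\rho:[a,b]\to\mathbb{R}$ be Hölder continuous of order $\lambda$. If $\tau>1/2$, then the iterated integral $$I_{a,b}(F_1,\dots,F_n)=\int_{a\le s_1\le\cdots\le s_n\le b}\rho(s_1)F_1(ds_1,s_1)F_2(ds_2,s_2)\cdots F_n(ds_n,s_n)$$ is well defined.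
   Context: The iterated integral is understood by integrating successively in $s_1,s_2,\dots,s_n$: $I^{(1)}(s)=\int_a^s\rho(r)F_1(dr,r)$, then $I^{(k)}(s)=\int_a^sI^{(k-1)}(r)F_k(dr,r)$ for $s\in[a,b]$, $k=2,\dots,n$, and $I_{a,b}(F_1,\dots,F_n)=I^{(n)}(b)$. For $h:[a,b]\to\mathbb{R}$, $F:[a,b]^2\to\mathbb{R}$ and $c\in(a,b]$, put $G(s,t)=h(t)F(s,t)$ and $G_{c-}(s,t)=G(s,t)-G(c,t)$. The integral $\int_a^ch(r)F(dr,r):=\int_a^cG(dr,r)$ is defined by $$\int_a^cG(dr,r)=(-1)^\alpha\int_a^cD_{a+}^{\alpha,t'}D_{c-}^{1-\alpha,t}G_{c-}(t,t')\big|_{t'=t}\,dt$$ whenever the right-hand side makes sense, where $\alpha\in(1-\tau,\min(\lambda,\tau))$; for $c=a$ the integral is $0$. Here, for $0<\alpha<1$, $$D_{a+}^{\alpha}f(t)=\frac{1}{\Gamma(1-\alpha)}\Big(\frac{f(t)}{(t-a)^\alpha}+\alpha\int_a^t\frac{f(t)-f(s)}{(t-s)^{\alpha+1}}ds\Big),\qquad D_{c-}^{\alpha}f(t)=\frac{(-1)^\alpha}{\Gamma(1-\alpha)}\Big(\frac{f(t)}{(c-t)^\alpha}+\alpha\int_t^c\frac{f(t)-f(s)}{(s-t)^{\alpha+1}}ds\Big),$$ with $(-1)^\alpha=e^{i\pi\alpha}$; the superscript variable indicates the variable in which the derivative is taken, and $|_{t'=t}$ means evaluation at $t'=t$ afterw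ards.
   Formalization: It is additionally assumed that s ↦ F_i(s,t) is Hölder continuous of order τ on [a,b] for each t; the rectangular bound alone does not suffice, since F(s,t)=f(s) with f non-measurable satisfies it but the integral is undefined. *)

theory Defs
  imports "HOL-Analysis.Analysis"
begin

definition holder_on :: "real \<Rightarrow> real set \<Rightarrow> (real \<Rightarrow> real) \<Rightarrow> bool" where
  "holder_on \<gamma> S f \<longleftrightarrow> (\<exists>C. \<forall>s\<in>S. \<forall>t\<in>S. \<bar>f s - f t\<bar> \<le> C * \<bar>s - t\<bar> powr \<gamma>)"

text \<open>The bound on rectangular increments only; it leaves an additive term
  \<open>f s + g t\<close> in \<open>F s t\<close> completely unrestricted.\<close>

definition rect_holder_on ::
    "real \<Rightarrow> real \<Rightarrow> real set \<Rightarrow> (real \<Rightarrow> real \<Rightarrow> real) \<Rightarrow> bool" where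
  "rect_holder_on \<tau> lam S F \<longleftrightarrow>
     (\<exists>C. \<forall>s1\<in>S. \<forall>s2\<in>S. \<forall>t1\<in>S. \<forall>t2\<in>S.
        \<bar>F s1 t1 - F s2 t1 - F s1 t2 + F s2 t2\<bar>
          \<le> C * \<bar>s1 - s2\<bar> powr \<tau> * \<bar>t1 - t2\<bar> powr lam)"

text \<open>Weyl--Marchaud fractional derivatives, of complex-valued functions because of the
  phase \<open>(-1)^\<alpha> = exp (\<i> * pi * \<alpha>) = cis (pi * \<alpha>)\<close>. The \<open>_exists\<close> predicates say that
  the defining integral at the point \<open>t\<close> converges absolutely. At the singular endpoint of
  the integrand HOL evaluates \<open>0 / 0 = 0\<close>, which is a null set.\<close>

definition frac_deriv_left :: "real \<Rightarrow> real \<Rightarrow> (real \<Rightarrow> complex) \<Rightarrow> real \<Rightarrow> complex" where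
  "frac_deriv_left \<alpha> a f t =
     1 / of_real (Gamma (1 - \<alpha>)) *
       (f t / of_real ((t - a) powr \<alpha>)
        + of_real \<alpha> * integral {a..t} (\<lambda>s. (f t - f s) / of_real ((t - s) powr (\<alpha> + 1))))"

definition frac_deriv_left_exists :: "real \<Rightarrow> real \<Rightarrow> (real \<Rightarrow> complex) \<Rightarrow> real \<Rightarrow> bool" where
  "frac_deriv_left_exists \<alpha> a f t \<longleftrightarrow>
     (\<lambda>s. (f t - f s) / of_real ((t - s) powr (\<alpha> + 1))) absolutely_integrable_on {a..t}"

definition frac_deriv_right :: "real \<Rightarrow> real \<Rightarrow> (real \<Rightarrow> complex) \<Rightarrow> real \<Rightarrow> complex" where
  "frac_deriv_right \<alpha> c f t =
     cis (pi * \<alpha>) / of_real (Gamma (1 - \<alpha>)) *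
       (f t / of_real ((c - t) powr \<alpha>)
        + of_real \<alpha> * integral {t..c} (\<lambda>s. (f t - f s) / of_real ((s - t) powr (\<alpha> + 1))))"

definition frac_deriv_right_exists :: "real \<Rightarrow> real \<Rightarrow> (real \<Rightarrow> complex) \<Rightarrow> real \<Rightarrow> bool" where
  "frac_deriv_right_exists \<alpha> c f t \<longleftrightarrow>
     (\<lambda>s. (f t - f s) / of_real ((s - t) powr (\<alpha> + 1))) absolutely_integrable_on {t..c}"

text \<open>\<open>frac_mixed \<alpha> c G t t'\<close> is the right derivative of order \<open>1 - \<alpha>\<close> of
  \<open>G s t' - G c t'\<close> in the variable \<open>s\<close>, at \<open>s = t\<close>; \<open>frac_integrand\<close> then takes the left
  derivative of order \<open>\<alpha>\<close> in \<open>t'\<close> with \<open>t\<close> frozen, and evaluates at \<open>t' = t\<close>.\<close>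

definition frac_mixed ::
    "real \<Rightarrow> real \<Rightarrow> (real \<Rightarrow> real \<Rightarrow> real) \<Rightarrow> real \<Rightarrow> real \<Rightarrow> complex" where
  "frac_mixed \<alpha> c G t t' =
     frac_deriv_right (1 - \<alpha>) c (\<lambda>s. of_real (G s t' - G c t')) t"

definition frac_integrand ::
    "real \<Rightarrow> real \<Rightarrow> real \<Rightarrow> (real \<Rightarrow> real \<Rightarrow> real) \<Rightarrow> real \<Rightarrow> complex" where
  "frac_integrand \<alpha> a c G t = frac_deriv_left \<alpha> a (frac_mixed \<alpha> c G t) t"

definition frac_integral :: "real \<Rightarrow> real \<Rightarrow> real \<Rightarrow> (real \<Rightarrow> real \<Rightarrow> real) \<Rightarrow> complex" where
  "frac_integral \<alpha> a c G = cis (pi * \<alpha>) * integral {a..c} (frac_integrand \<alpha> a c G)"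

definition frac_integral_exists ::
    "real \<Rightarrow> real \<Rightarrow> real \<Rightarrow> (real \<Rightarrow> real \<Rightarrow> real) \<Rightarrow> bool" where
  "frac_integral_exists \<alpha> a c G \<longleftrightarrow>
     (\<forall>t\<in>{a<..<c}. \<forall>t'\<in>{a..c}.
        frac_deriv_right_exists (1 - \<alpha>) c (\<lambda>s. of_real (G s t' - G c t')) t) \<and>
     (\<forall>t\<in>{a<..<c}. frac_deriv_left_exists \<alpha> a (frac_mixed \<alpha> c G t) t) \<and>
     frac_integrand \<alpha> a c G absolutely_integrable_on {a..c}"

text \<open>The integral of \<open>h r\<close> against \<open>F (dr, r)\<close> over \<open>[a, c]\<close>. Since the defining formula
  involves an auxiliary order \<open>\<alpha>\<close>, the integral is well defined if there is an admissible
  \<open>\<alpha>\<close>, the formula makes sense for all of them, and all give the same real value.\<close>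

definition has_nl_integral ::
    "real \<Rightarrow> real \<Rightarrow> real \<Rightarrow> real \<Rightarrow> (real \<Rightarrow> real) \<Rightarrow> (real \<Rightarrow> real \<Rightarrow> real) \<Rightarrow> real \<Rightarrow> bool" where
  "has_nl_integral \<tau> lam a c h F v \<longleftrightarrow>
     (if c = a then v = 0
      else a < c \<and> {1 - \<tau><..<min lam \<tau>} \<noteq> {} \<and>
        (\<forall>\<alpha>\<in>{1 - \<tau><..<min lam \<tau>}.
           frac_integral_exists \<alpha> a c (\<lambda>s t. h t * F s t) \<and>
           frac_integral \<alpha> a c (\<lambda>s t. h t * F s t) = of_real v))"

definition nl_integrable ::
    "real \<Rightarrow> real \<Rightarrow> real \<Rightarrow> real \<Rightarrow> (real \<Rightarrow> real) \<Rightarrow> (real \<Rightarrow> real \<Rightarrow> real) \<Rightarrow> bool" where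
  "nl_integrable \<tau> lam a c h F \<longleftrightarrow> (\<exists>v. has_nl_integral \<tau> lam a c h F v)"

definition nl_integral ::
    "real \<Rightarrow> real \<Rightarrow> real \<Rightarrow> real \<Rightarrow> (real \<Rightarrow> real) \<Rightarrow> (real \<Rightarrow> real \<Rightarrow> real) \<Rightarrow> real" where
  "nl_integral \<tau> lam a c h F = (THE v. has_nl_integral \<tau> lam a c h F v)"

text \<open>The integrators are \<open>F 1, \<dots>, F n\<close>; stage \<open>0\<close> is the weight \<open>\<rho>\<close>, so that stage \<open>1\<close> is
  the integral of \<open>\<rho>\<close> against \<open>F 1\<close>.\<close>

primrec iterated_stage ::
    "real \<Rightarrow> real \<Rightarrow> real \<Rightarrow> (real \<Rightarrow> real) \<Rightarrow> (nat \<Rightarrow> real \<Rightarrow> real \<Rightarrow> real)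
      \<Rightarrow> nat \<Rightarrow> real \<Rightarrow> real" where
  "iterated_stage \<tau> lam a \<rho> F 0 = \<rho>"
| "iterated_stage \<tau> lam a \<rho> F (Suc k) =
     (\<lambda>s. nl_integral \<tau> lam a s (iterated_stage \<tau> lam a \<rho> F k) (F (Suc k)))"

definition iterated_integral_well_defined ::
    "real \<Rightarrow> real \<Rightarrow> real \<Rightarrow> real \<Rightarrow> (real \<Rightarrow> real) \<Rightarrow> (nat \<Rightarrow> real \<Rightarrow> real \<Rightarrow> real)
      \<Rightarrow> nat \<Rightarrow> bool" where
  "iterated_integral_well_defined \<tau> lam a b \<rho> F n \<longleftrightarrow>
     (\<forall>k\<in>{1..n}. \<forall>s\<in>{a..b}.
        nl_integrable \<tau> lam a s (iterated_stage \<tau> lam a \<rho> F (k - 1)) (F k))"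

end

theory Submission
  imports Defs
begin

text \<open>Write the defining formula with \<open>P s t = G s t - G c t\<close>, extended by zero to \<open>s \<ge> c\<close> and to
  \<open>t < a\<close>. The boundary terms of the two Marchaud derivatives disappear, and up to the factor
  \<open>- \<alpha> (1 - \<alpha>) / (\<Gamma> \<alpha> \<Gamma> (1 - \<alpha>))\<close> the formula becomes the absolutely convergent triple integral of
  \<open>v powr (- \<alpha> - 1) u powr (\<alpha> - 2) [P t t - P (t + u) t - P t (t - v) + P (t + u) (t - v)]\<close> over
  \<open>u, v > 0\<close> and \<open>t\<close>. Integrating in \<open>t\<close> first leaves the second difference
  \<open>A 0 - A u - A v + A (u + v)\<close> of the one-variable function \<open>A w = \<integral> P (t + w) t dt\<close>.
  If \<open>A\<close> is \<open>C\<^sup>2\<close> with compact support, Tonelli and the Beta integral evaluate the remaining integral to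
  \<open>- B \<alpha> (1 - \<alpha>) / (\<alpha> (1 - \<alpha>)) A' 0\<close>; averaging and dominated convergence extend this to
  the \<open>A\<close> at hand. The integral is therefore the limit of \<open>(A \<epsilon> - A 0) / \<epsilon>\<close>, that is of
  \<open>1/\<epsilon> \<integral> h t (F (min (t + \<epsilon>) c) t - F t t) dt\<close>. This is independent of \<open>\<alpha>\<close> and additive in
  the interval, and the triple integral bounds it by a multiple of \<open>(c - a) powr \<tau>\<close>. So every stage is
  again Hoelder continuous and the iteration proceeds.\<close>

subsection \<open>Marchaud derivatives as integrals over the half-line\<close>

text \<open>The kernel in \<open>v\<close> meets a bound of order \<open>\<beta>\<close> and the
  kernel in \<open>u\<close> a bound of order \<open>\<tau>\<close>. Convergence at 0 therefore asks
  for \<alpha> < \<beta> and 1 - \<alpha> < \<tau>, which for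
  \<open>\<beta> = min lam \<tau>\<close> is exactly the admissible window of orders. A stage
  inherits order \<tau> from its integrator, whatever the order of the weight, so the iteration runs
  with weights of order \<open>min lam \<tau>\<close>; \<tau> > 1/2 and \<tau> + lam > 1 together
  say that 1 - \<tau> lies below this minimum. The rectangular bound says nothing about a summand f
  s of the integrator, and such a summand survives in every increment in s. Hence the separate
  Hoelder bound in the first argument. A summand g t cancels. The main obstacle is independence of
  \<alpha>. Nothing known beforehand makes the moment function \<open>A\<close> differentiable at 0;
  that its difference quotients converge is read off from the triple integral, by smoothing
  \<open>A\<close> in a way that preserves the bound on its second differences.\<close>

definition marchaud_kernel :: "real \<Rightarrow> real \<Rightarrow> real" where
  "marchaud_kernel \<gamma> x = (if 0 < x then x powr (- \<gamma> - 1) else 0)"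

lemma marchaud_kernel_measurable [measurable]: "marchaud_kernel \<gamma> \<in> borel_measurable borel"
  unfolding marchaud_kernel_def[abs_def] by measurable

lemma marchaud_kernel_nonneg [simp]: "0 \<le> marchaud_kernel \<gamma> x"
  by (simp add: marchaud_kernel_def)

text \<open>The closed form of the integral of
  \<open>x powr (- \<gamma> - 1) * min x L powr \<sigma>\<close> over x > 0: the interval up to L
  contributes the summand with 1 / (\<sigma> - \<gamma>), the tail beyond L the one with 1 /
  \<gamma>.\<close>

definition truncated_kernel_mass :: "real \<Rightarrow> real \<Rightarrow> real \<Rightarrow> real" where
  "truncated_kernel_mass \<gamma> \<sigma> L = L powr (\<sigma> - \<gamma>) * (1 / (\<sigma> - \<gamma>) + 1 / \<gamma>)"

lemma has_bochner_integral_truncated_kernel: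
  assumes "0 < \<gamma>" "\<gamma> < \<sigma>" "0 < L"
  shows "has_bochner_integral lborel (\<lambda>x. marchaud_kernel \<gamma> x * min x L powr \<sigma>)
           (truncated_kernel_mass \<gamma> \<sigma> L)"
proof -
  let ?f = "\<lambda>x. marchaud_kernel \<gamma> x * min x L powr \<sigma>"
  have "((\<lambda>x. x powr (\<sigma> - \<gamma> - 1)) has_integral (L powr (\<sigma> - \<gamma>) / (\<sigma> - \<gamma>))) {0..L}"
    using has_integral_powr_from_0[of "\<sigma> - \<gamma> - 1" L] assms by simp
  then have 1: "(?f has_integral (L powr (\<sigma> - \<gamma>) / (\<sigma> - \<gamma>))) {0..L}"
    by (rule has_integral_eq[rotated]) (auto simp: marchaud_kernel_def powr_add[symmetric] algebra_simps)
  have "((\<lambda>x. L powr \<sigma> * x powr (- \<gamma> - 1)) has_integral (L powr \<sigma> * (- (L powr (- \<gamma>)) / (- \<gamma>)))) {L..}"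
    using has_integral_powr_to_inf[of "- \<gamma> - 1" L] assms by (intro has_integral_mult_right) simp
  then have "((\<lambda>x. L powr \<sigma> * x powr (- \<gamma> - 1)) has_integral (L powr (\<sigma> - \<gamma>) / \<gamma>)) {L..}"
    by (simp add: powr_diff powr_minus divide_simps)
  then have 2: "(?f has_integral (L powr (\<sigma> - \<gamma>) / \<gamma>)) {L..}"
    by (rule has_integral_eq[rotated]) (use assms in \<open>auto simp: marchaud_kernel_def\<close>)
  have "(?f has_integral (L powr (\<sigma> - \<gamma>) / (\<sigma> - \<gamma>) + L powr (\<sigma> - \<gamma>) / \<gamma>)) ({0..L} \<union> {L..})"
    using assms by (intro has_integral_Un 1 2 negligible_subset[OF negligible_sing[of L]]) auto
  also have "L powr (\<sigma> - \<gamma>) / (\<sigma> - \<gamma>) + L powr (\<sigma> - \<gamma>) / \<gamma> = truncated_kernel_mass \<gamma> \<sigma> L"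
    by (simp add: truncated_kernel_mass_def algebra_simps)
  finally have "(?f has_integral truncated_kernel_mass \<gamma> \<sigma> L) ({0..L} \<union> {L..})" .
  then have "(?f has_integral truncated_kernel_mass \<gamma> \<sigma> L) UNIV"
    by (rule has_integral_on_superset) (use assms in \<open>auto simp: marchaud_kernel_def\<close>)
  then have "(\<integral>\<^sup>+x. ?f x \<partial>lborel) = ennreal (truncated_kernel_mass \<gamma> \<sigma> L)"
    by (intro nn_integral_has_integral_lborel) auto
  moreover have "0 \<le> truncated_kernel_mass \<gamma> \<sigma> L"
    using assms by (simp add: truncated_kernel_mass_def)
  ultimately show ?thesis
    by (intro has_bochner_integral_nn_integral) auto
qed

lemma has_bochner_integral_kernel_tail:
  assumes "0 < \<gamma>" "0 < L"
  shows "has_bochner_integral lborel (\<lambda>x. indicator {L<..} x * marchaud_kernel \<gamma> x)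
           (L powr (- \<gamma>) / \<gamma>)"
proof -
  let ?f = "\<lambda>x. indicator {L<..} x * marchaud_kernel \<gamma> x"
  have "((\<lambda>x. x powr (- \<gamma> - 1)) has_integral (L powr (- \<gamma>) / \<gamma>)) {L..}"
    using has_integral_powr_to_inf[of "- \<gamma> - 1" L] assms by simp
  then have "(?f has_integral (L powr (- \<gamma>) / \<gamma>)) {L..}"
    by (rule has_integral_spike[where S = "{L}", rotated 2])
       (use assms in \<open>auto simp: marchaud_kernel_def\<close>)
  then have "(?f has_integral (L powr (- \<gamma>) / \<gamma>)) UNIV"
    by (rule has_integral_on_superset) (use assms in auto)
  then have "(\<integral>\<^sup>+x. ?f x \<partial>lborel) = ennreal (L powr (- \<gamma>) / \<gamma>)"
    by (intro nn_integral_has_integral_lborel) auto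
  then show ?thesis
    using assms by (intro has_bochner_integral_nn_integral) auto
qed

text \<open>Extending \<open>f\<close> by zero beyond \<open>c\<close> absorbs the boundary term \<open>f t / (c - t) powr \<gamma>\<close>.\<close>

lemma
  fixes f :: "real \<Rightarrow> real"
  assumes f [measurable]: "f \<in> borel_measurable borel" and tc: "t < c"
    and zero: "\<And>s. c < s \<Longrightarrow> f s = 0"
    and holder: "\<And>s. t \<le> s \<Longrightarrow> s \<le> c \<Longrightarrow> \<bar>f t - f s\<bar> \<le> K * \<bar>s - t\<bar> powr \<sigma>"
    and \<gamma>: "0 < \<gamma>" "\<gamma> < \<sigma>"
  shows integrable_marchaud_right:
      "integrable lborel (\<lambda>u. marchaud_kernel \<gamma> u * (f t - f (t + u)))"
    and absolutely_integrable_marchaud_right: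
      "(\<lambda>s. (f t - f s) / (s - t) powr (\<gamma> + 1)) absolutely_integrable_on {t..c}"
    and marchaud_right_eq:
      "f t / (c - t) powr \<gamma> + \<gamma> * integral {t..c} (\<lambda>s. (f t - f s) / (s - t) powr (\<gamma> + 1))
        = \<gamma> * (\<integral>u. marchaud_kernel \<gamma> u * (f t - f (t + u)) \<partial>lborel)"
proof -
  let ?w = "\<lambda>u. marchaud_kernel \<gamma> u * (f t - f (t + u))"
  define L where "L = c - t"
  have L: "0 < L" using tc by (simp add: L_def)
  \<comment> \<open>Beyond \<open>c\<close> the difference is f t itself and no Hoelder bound
    applies. Including \<open>\<bar>f t\<bar> / L powr \<sigma>\<close> in the constant lets a
    single bound in \<open>min u L\<close> cover both ranges.\<close>
  define K' where "K' = max K (\<bar>f t\<bar> / L powr \<sigma>)"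
  have bnd: "\<bar>f t - f (t + u)\<bar> \<le> K' * min u L powr \<sigma>" if "0 < u" for u
  proof (cases "u \<le> L")
    case True
    then have "\<bar>f t - f (t + u)\<bar> \<le> K * u powr \<sigma>"
      using holder[of "t + u"] that by (simp add: L_def)
    also have "\<dots> \<le> K' * min u L powr \<sigma>"
      using True by (simp add: K'_def mult_right_mono)
    finally show ?thesis .
  next
    case False
    then have "f (t + u) = 0" by (intro zero) (simp add: L_def)
    moreover have "\<bar>f t\<bar> / L powr \<sigma> \<le> K'" by (simp add: K'_def)
    ultimately show ?thesis using False L by (simp add: field_simps)
  qed
  show I: "integrable lborel ?w"
  proof (rule Bochner_Integration.integrable_bound)
    show "integrable lborel (\<lambda>u. K' * (marchaud_kernel \<gamma> u * min u L powr \<sigma>))"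
      using has_bochner_integral_truncated_kernel[OF \<gamma> L]
      by (intro integrable_mult_right) (rule integrable.intros)
    show "AE u in lborel. norm (?w u) \<le> norm (K' * (marchaud_kernel \<gamma> u * min u L powr \<sigma>))"
    proof (rule AE_I2)
      fix u
      show "norm (?w u) \<le> norm (K' * (marchaud_kernel \<gamma> u * min u L powr \<sigma>))"
      proof (cases "0 < u")
        case True
        have "norm (?w u) \<le> marchaud_kernel \<gamma> u * (K' * min u L powr \<sigma>)"
          using bnd[OF True] by (simp add: abs_mult mult_left_mono)
        also have "\<dots> \<le> norm (K' * (marchaud_kernel \<gamma> u * min u L powr \<sigma>))"
          by (simp add: mult.left_commute)
        finally show ?thesis .
      qed (simp add: marchaud_kernel_def)
    qed
  qed measurable
  let ?g = "\<lambda>s. (f t - f s) / (s - t) powr (\<gamma> + 1)"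
  \<comment> \<open>With s = t + u the half-line integrand is the Marchaud quotient on {t..c} plus f
    t times the kernel beyond L. The mass \<open>L powr (- \<gamma>) / \<gamma>\<close> of that
    tail, multiplied by \<gamma>, is the boundary term.\<close>
  have split: "?w (- t + 1 * s) = indicator {t..c} s *\<^sub>R ?g s
      + f t * (indicator {L<..} (- t + 1 * s) * marchaud_kernel \<gamma> (- t + 1 * s))" for s
    using tc zero[of s]
    by (cases "s \<le> t"; cases "s \<le> c")
       (auto simp: marchaud_kernel_def L_def indicator_def powr_minus powr_diff powr_add divide_simps)
  have Iw: "integrable lborel (\<lambda>s. ?w (- t + 1 * s))"
    by (rule lborel_integrable_real_affine[OF I]) simp
  have tail: "has_bochner_integral lborel (\<lambda>s. f t * (indicator {L<..} (- t + 1 * s) * marchaud_kernel \<gamma> (- t + 1 * s)))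
      (f t * (L powr (- \<gamma>) / \<gamma>))"
    by (intro has_bochner_integral_mult_right)
       (use iffD1[OF lborel_has_bochner_integral_real_affine_iff[of 1 _ _ "- t"]
          has_bochner_integral_kernel_tail[OF \<gamma>(1) L]] in simp)
  have "integrable lborel (\<lambda>s. ?w (- t + 1 * s)
     - f t * (indicator {L<..} (- t + 1 * s) * marchaud_kernel \<gamma> (- t + 1 * s)))"
    by (rule Bochner_Integration.integrable_diff[OF Iw integrable.intros[OF tail]])
  then have Ig: "set_integrable lborel {t..c} ?g"
    unfolding split set_integrable_def by simp
  then show "?g absolutely_integrable_on {t..c}"
    unfolding set_integrable_def by (subst integrable_completion) auto
  have "(\<integral>u. ?w u \<partial>lborel) = (\<integral>s. ?w (- t + 1 * s) \<partial>lborel)"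
    by (subst lborel_integral_real_affine[of 1 _ "-t"]) auto
  also have "\<dots> = (\<integral>s. indicator {t..c} s *\<^sub>R ?g s \<partial>lborel) + f t * (L powr (- \<gamma>) / \<gamma>)"
    unfolding split using Ig tail
    by (subst Bochner_Integration.integral_add) (auto simp: has_bochner_integral_iff set_integrable_def)
  also have "(\<integral>s. indicator {t..c} s *\<^sub>R ?g s \<partial>lborel) = integral {t..c} ?g"
    using set_borel_integral_eq_integral(2)[OF Ig] by (simp add: set_lebesgue_integral_def)
  finally show "f t / (c - t) powr \<gamma> + \<gamma> * integral {t..c} ?g = \<gamma> * (\<integral>u. ?w u \<partial>lborel)"
    using \<gamma> L by (simp add: L_def powr_minus field_simps)
qed

text \<open>The reflection s -> - s turns the left derivative at t with base a into the right
  derivative at - t with base - a.\<close>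

lemma
  fixes f :: "real \<Rightarrow> real"
  assumes f [measurable]: "f \<in> borel_measurable borel" and at: "a < t"
    and zero: "\<And>s. s < a \<Longrightarrow> f s = 0"
    and holder: "\<And>s. a \<le> s \<Longrightarrow> s \<le> t \<Longrightarrow> \<bar>f t - f s\<bar> \<le> K * \<bar>s - t\<bar> powr \<sigma>"
    and \<gamma>: "0 < \<gamma>" "\<gamma> < \<sigma>"
  shows absolutely_integrable_marchaud_left:
      "(\<lambda>s. (f t - f s) / (t - s) powr (\<gamma> + 1)) absolutely_integrable_on {a..t}"
    and marchaud_left_eq:
      "f t / (t - a) powr \<gamma> + \<gamma> * integral {a..t} (\<lambda>s. (f t - f s) / (t - s) powr (\<gamma> + 1))
        = \<gamma> * (\<integral>u. marchaud_kernel \<gamma> u * (f t - f (t - u)) \<partial>lborel)"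
proof -
  have h: "\<bar>f (- (- t)) - f (- s)\<bar> \<le> K * \<bar>s - - t\<bar> powr \<sigma>" if "- t \<le> s" "s \<le> - a" for s
    using holder[of "- s"] that by (simp add: abs_minus_commute add.commute)
  note * = absolutely_integrable_marchaud_right[where f = "\<lambda>s. f (- s)" and t = "- t" and c = "- a", OF _ _ _ h \<gamma>]
    marchaud_right_eq[where f = "\<lambda>s. f (- s)" and t = "- t" and c = "- a", OF _ _ _ h \<gamma>]
  let ?g = "\<lambda>s. (f t - f s) / (t - s) powr (\<gamma> + 1)"
  have g: "(\<lambda>s. (f (- (- t)) - f (- s)) / (s - - t) powr (\<gamma> + 1)) = (\<lambda>s. ?g (- s))"
    by (simp add: add.commute)
  show "?g absolutely_integrable_on {a..t}"
  proof -
    have "(\<lambda>s. ?g (- s)) absolutely_integrable_on {- t..- a}"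
      using *(1)[unfolded g] at zero by simp
    then show ?thesis by (subst (asm) absolutely_integrable_reflect_real)
  qed
  have "f t / (t - a) powr \<gamma> + \<gamma> * integral {- t..- a} (\<lambda>s. ?g (- s))
        = \<gamma> * (\<integral>u. marchaud_kernel \<gamma> u * (f t - f (t - u)) \<partial>lborel)"
    using *(2)[unfolded g] at zero by simp
  then show "f t / (t - a) powr \<gamma> + \<gamma> * integral {a..t} ?g
        = \<gamma> * (\<integral>u. marchaud_kernel \<gamma> u * (f t - f (t - u)) \<partial>lborel)"
    unfolding Henstock_Kurzweil_Integration.integral_reflect_real[where f = ?g and a = a and b = t] .
qed

section \<open>Tonelli identities for power kernels\<close>

text \<open>By Tonelli each y collects the kernel mass of all v > y, which is
  \<open>y powr (- \<gamma>) / \<gamma>\<close>. This trades the singular kernel acting on a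
  primitive of k for a locally integrable power acting on k.\<close>

lemma nn_integral_kernel_primitive:
  assumes k [measurable]: "k \<in> borel_measurable borel" and \<gamma>: "0 < \<gamma>"
  shows "(\<integral>\<^sup>+v. ennreal (marchaud_kernel \<gamma> v) * (\<integral>\<^sup>+y. indicator {0<..<v} y * k y \<partial>lborel) \<partial>lborel)
       = (\<integral>\<^sup>+y. ennreal (indicator {0<..} y * (y powr (- \<gamma>) / \<gamma>)) * k y \<partial>lborel)"
proof -
  have "(\<integral>\<^sup>+v. ennreal (marchaud_kernel \<gamma> v) * (\<integral>\<^sup>+y. indicator {0<..<v} y * k y \<partial>lborel) \<partial>lborel)
      = (\<integral>\<^sup>+v. \<integral>\<^sup>+y. ennreal (marchaud_kernel \<gamma> v) * ((if 0 < y \<and> y < v then 1 else 0) * k y) \<partial>lborel \<partial>lborel)"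
    by (subst nn_integral_cmult) (auto simp: indicator_def of_bool_def)
  also have "\<dots> = (\<integral>\<^sup>+y. \<integral>\<^sup>+v. ennreal (marchaud_kernel \<gamma> v) * ((if 0 < y \<and> y < v then 1 else 0) * k y) \<partial>lborel \<partial>lborel)"
    by (rule lborel_pair.Fubini') measurable
  also have "\<dots> = (\<integral>\<^sup>+y. ennreal (indicator {0<..} y * (y powr (- \<gamma>) / \<gamma>)) * k y \<partial>lborel)"
  proof (rule nn_integral_cong)
    fix y :: real
    show "(\<integral>\<^sup>+v. ennreal (marchaud_kernel \<gamma> v) * ((if 0 < y \<and> y < v then 1 else 0) * k y) \<partial>lborel)
        = ennreal (indicator {0<..} y * (y powr (- \<gamma>) / \<gamma>)) * k y"
    proof (cases "0 < y")
      case True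
      have "(\<integral>\<^sup>+v. ennreal (marchaud_kernel \<gamma> v) * ((if 0 < y \<and> y < v then 1 else 0) * k y) \<partial>lborel)
          = (\<integral>\<^sup>+v. ennreal (indicator {y<..} v * marchaud_kernel \<gamma> v) * k y \<partial>lborel)"
        using True by (intro nn_integral_cong) (auto simp: indicator_def)
      also have "\<dots> = (\<integral>\<^sup>+v. ennreal (indicator {y<..} v * marchaud_kernel \<gamma> v) \<partial>lborel) * k y"
        by (rule nn_integral_multc) measurable
      also have "(\<integral>\<^sup>+v. ennreal (indicator {y<..} v * marchaud_kernel \<gamma> v) \<partial>lborel)
          = ennreal (y powr (- \<gamma>) / \<gamma>)"
        using has_bochner_integral_kernel_tail[OF \<gamma> True]
        by (subst nn_integral_eq_integral) (auto simp: has_bochner_integral_iff)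
      finally show ?thesis using True by simp
    qed simp
  qed
  finally show ?thesis .
qed

text \<open>The powers of orders - \<alpha> and \<alpha> - 1 convolve to a constant: rescaling y to
  z * y produces z to the exponent 1 - \<alpha> + (\<alpha> - 1) = 0, and what remains is the Beta
  integral over the unit interval.\<close>

lemma nn_integral_beta_convolution:
  fixes g :: "real \<Rightarrow> ennreal"
  assumes g [measurable]: "g \<in> borel_measurable borel" and \<alpha>: "0 < \<alpha>" "\<alpha> < 1"
  shows "(\<integral>\<^sup>+y. ennreal (indicator {0<..} y * y powr (- \<alpha>)) *
            (\<integral>\<^sup>+x. ennreal (indicator {0<..} x * x powr (\<alpha> - 1)) * g (x + y) \<partial>lborel) \<partial>lborel)
       = ennreal (Beta \<alpha> (1 - \<alpha>)) * (\<integral>\<^sup>+z. indicator {0<..} z * g z \<partial>lborel)"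
proof -
  have beta: "(\<integral>\<^sup>+y. ennreal (indicator {0<..<1} y * (y powr (- \<alpha>) * (1 - y) powr (\<alpha> - 1))) \<partial>lborel)
      = ennreal (Beta \<alpha> (1 - \<alpha>))"
  proof -
    have "((\<lambda>t. t powr (- \<alpha>) * (1 - t) powr (\<alpha> - 1)) has_integral Beta \<alpha> (1 - \<alpha>)) {0..1}"
      using has_integral_Beta_real[of "1 - \<alpha>" \<alpha>] \<alpha> by (simp add: Beta_commute)
    then have "((\<lambda>y. indicator {0<..<1} y * (y powr (- \<alpha>) * (1 - y) powr (\<alpha> - 1)))
        has_integral Beta \<alpha> (1 - \<alpha>)) {0..1}"
      by (rule has_integral_spike[where S = "{0, 1}", rotated 2]) auto
    then have "((\<lambda>y. indicator {0<..<1} y * (y powr (- \<alpha>) * (1 - y) powr (\<alpha> - 1)))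
        has_integral Beta \<alpha> (1 - \<alpha>)) UNIV"
      by (rule has_integral_on_superset) auto
    then show ?thesis
      by (intro nn_integral_has_integral_lborel) auto
  qed
  have "(\<integral>\<^sup>+y. ennreal (indicator {0<..} y * y powr (- \<alpha>)) *
            (\<integral>\<^sup>+x. ennreal (indicator {0<..} x * x powr (\<alpha> - 1)) * g (x + y) \<partial>lborel) \<partial>lborel)
      = (\<integral>\<^sup>+y. ennreal (indicator {0<..} y * y powr (- \<alpha>)) *
            (\<integral>\<^sup>+z. ennreal (indicator {0<..} (z - y) * (z - y) powr (\<alpha> - 1)) * g z \<partial>lborel) \<partial>lborel)"
  proof -
    have "(\<integral>\<^sup>+z. ennreal (indicator {0<..} (z - y) * (z - y) powr (\<alpha> - 1)) * g z \<partial>lborel)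
       = (\<integral>\<^sup>+x. ennreal (indicator {0<..} x * x powr (\<alpha> - 1)) * g (x + y) \<partial>lborel)" for y
      by (subst nn_integral_real_affine[where c = 1 and t = y]) (auto simp: add.commute)
    then show ?thesis by simp
  qed
  also have "\<dots> = (\<integral>\<^sup>+y. \<integral>\<^sup>+z. ennreal (indicator {0<..} y * y powr (- \<alpha>)) *
            (ennreal ((if y < z then 1 else 0) * (z - y) powr (\<alpha> - 1)) * g z) \<partial>lborel \<partial>lborel)"
    by (subst nn_integral_cmult) (auto simp: indicator_def of_bool_def)
  also have "\<dots> = (\<integral>\<^sup>+z. \<integral>\<^sup>+y. ennreal (indicator {0<..} y * y powr (- \<alpha>)) *
            (ennreal ((if y < z then 1 else 0) * (z - y) powr (\<alpha> - 1)) * g z) \<partial>lborel \<partial>lborel)"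
    by (rule lborel_pair.Fubini') measurable
  also have "\<dots> = (\<integral>\<^sup>+z. ennreal (Beta \<alpha> (1 - \<alpha>)) * (indicator {0<..} z * g z) \<partial>lborel)"
  proof (rule nn_integral_cong)
    fix z :: real
    let ?h = "\<lambda>y. indicator {0<..<z} y * (y powr (- \<alpha>) * (z - y) powr (\<alpha> - 1))"
    have "(\<integral>\<^sup>+y. ennreal (indicator {0<..} y * y powr (- \<alpha>)) *
            (ennreal ((if y < z then 1 else 0) * (z - y) powr (\<alpha> - 1)) * g z) \<partial>lborel)
        = (\<integral>\<^sup>+y. ennreal (?h y) * g z \<partial>lborel)"
      by (intro nn_integral_cong) (auto simp: indicator_def ennreal_mult mult.assoc)
    also have "\<dots> = (\<integral>\<^sup>+y. ennreal (?h y) \<partial>lborel) * g z"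
      by (rule nn_integral_multc) measurable
    also have "(\<integral>\<^sup>+y. ennreal (?h y) \<partial>lborel) = indicator {0<..} z * ennreal (Beta \<alpha> (1 - \<alpha>))"
    proof (cases "0 < z")
      case True
      have "(\<integral>\<^sup>+y. ennreal (?h y) \<partial>lborel) = ennreal \<bar>z\<bar> * (\<integral>\<^sup>+y. ennreal (?h (0 + z * y)) \<partial>lborel)"
        using True by (intro nn_integral_real_affine) auto
      also have "\<dots> = (\<integral>\<^sup>+y. ennreal z * ennreal (?h (z * y)) \<partial>lborel)"
        using True by (subst nn_integral_cmult) auto
      also have "\<dots> = (\<integral>\<^sup>+y. ennreal (indicator {0<..<1} y * (y powr (- \<alpha>) * (1 - y) powr (\<alpha> - 1))) \<partial>lborel)"
      proof (rule nn_integral_cong)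
        fix y :: real
        have "z * ?h (z * y) = indicator {0<..<1} y * (y powr (- \<alpha>) * (1 - y) powr (\<alpha> - 1))"
        proof (cases "0 < y \<and> y < 1")
          case yes: True
          have "z - z * y = z * (1 - y)" by (simp add: algebra_simps)
          then have "z * ((z * y) powr (- \<alpha>) * (z - z * y) powr (\<alpha> - 1))
              = (z powr 1 * z powr (- \<alpha>) * z powr (\<alpha> - 1)) * (y powr (- \<alpha>) * (1 - y) powr (\<alpha> - 1))"
            using True yes by (simp add: powr_mult)
          also have "z powr 1 * z powr (- \<alpha>) * z powr (\<alpha> - 1) = 1"
            using True by (subst powr_add[symmetric])+ simp
          finally show ?thesis using True yes by (simp add: indicator_def)
        next
          case False
          then show ?thesis using True by (auto simp: indicator_def zero_less_mult_iff)
        qed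
        then show "ennreal z * ennreal (?h (z * y))
            = ennreal (indicator {0<..<1} y * (y powr (- \<alpha>) * (1 - y) powr (\<alpha> - 1)))"
          using True by (metis ennreal_mult' less_imp_le)
      qed
      finally show ?thesis using True beta by simp
    next
      case False
      then have "\<And>y. ?h y = 0" by (auto simp: indicator_def)
      then show ?thesis using False by simp
    qed
    finally show "(\<integral>\<^sup>+y. ennreal (indicator {0<..} y * y powr (- \<alpha>)) *
            (ennreal ((if y < z then 1 else 0) * (z - y) powr (\<alpha> - 1)) * g z) \<partial>lborel)
        = ennreal (Beta \<alpha> (1 - \<alpha>)) * (indicator {0<..} z * g z)"
      by (simp add: mult_ac)
  qed
  also have "\<dots> = ennreal (Beta \<alpha> (1 - \<alpha>)) * (\<integral>\<^sup>+z. indicator {0<..} z * g z \<partial>lborel)"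
    by (rule nn_integral_cmult) measurable
  finally show ?thesis .
qed

subsection \<open>Second differences of smooth functions\<close>

definition second_diff :: "(real \<Rightarrow> real) \<Rightarrow> real \<Rightarrow> real \<Rightarrow> real \<Rightarrow> real" where
  "second_diff f w u v = f w - f (w + u) - f (w + v) + f (w + u + v)"

lemma has_real_derivative_shift_arg:
  assumes "\<And>x. (f has_real_derivative f' x) (at x)"
  shows "((\<lambda>x. f (x + d)) has_real_derivative f' (x + d)) (at x)"
    and "((\<lambda>x. f (d + x)) has_real_derivative f' (d + x)) (at x)"
  using assms DERIV_shift[of f "f' (x + d)" x d] by (simp_all add: add.commute)

text \<open>The fundamental theorem of calculus applied in y and then in x. Nonnegativity of g makes
  \<phi> monotone, so the inner value is a nonnegative increment and passes through
  \<open>ennreal\<close> unharmed.\<close>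

lemma nn_integral_second_diff:
  assumes f: "\<And>x. (f has_real_derivative \<phi> x) (at x)"
    and \<phi>: "\<And>x. (\<phi> has_real_derivative g x) (at x)"
    and g: "g \<in> borel_measurable borel" "\<And>x. 0 \<le> g x" and uv: "0 < u" "0 < v"
  shows "(\<integral>\<^sup>+x. indicator {0<..<u} x * (\<integral>\<^sup>+y. indicator {0<..<v} y * ennreal (g (x + y)) \<partial>lborel) \<partial>lborel)
      = ennreal (second_diff f 0 u v)"
proof -
  have [measurable]: "g \<in> borel_measurable borel" by (fact g)
  have cont: "continuous_on UNIV \<phi>" "continuous_on UNIV f"
    using \<phi> f by (auto intro: DERIV_continuous_on has_field_derivative_at_within)
  have [measurable]: "\<phi> \<in> borel_measurable borel" "f \<in> borel_measurable borel"
    using cont by (auto intro: borel_measurable_continuous_onI)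
  have mono: "\<phi> x \<le> \<phi> y" if "x \<le> y" for x y
    using that \<phi> g(2) by (intro DERIV_nonneg_imp_nondecreasing[of x y \<phi>]) auto
  \<comment> \<open>The kernel identities use open intervals, the fundamental theorem closed ones;
    the two endpoints are null.\<close>
  have open_closed: "(\<integral>\<^sup>+y. indicator {0<..<v} y * h y \<partial>lborel) = (\<integral>\<^sup>+y. h y * indicator {0..v} y \<partial>lborel)"
    for h :: "real \<Rightarrow> ennreal" and v :: real
  proof (rule nn_integral_cong_AE)
    show "AE y in lborel. indicator {0<..<v} y * h y = h y * indicator {0..v} y"
      using AE_lborel_singleton[of 0] AE_lborel_singleton[of v]
      by eventually_elim (auto simp: indicator_def)
  qed
  have inner: "(\<integral>\<^sup>+y. indicator {0<..<v} y * ennreal (g (x + y)) \<partial>lborel) = ennreal (\<phi> (x + v) - \<phi> x)" for x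
    unfolding open_closed
    by (subst nn_integral_FTC_Icc[where F = "\<lambda>y. \<phi> (x + y)"])
       (use g uv in \<open>auto intro!: derivative_eq_intros has_real_derivative_shift_arg[OF \<phi>]\<close>)
  have "(\<integral>\<^sup>+x. indicator {0<..<u} x * ennreal (\<phi> (x + v) - \<phi> x) \<partial>lborel)
      = ennreal ((f (u + v) - f u) - (f (0 + v) - f 0))"
    unfolding open_closed
    by (subst nn_integral_FTC_Icc[where F = "\<lambda>x. f (x + v) - f x"])
       (use uv mono in \<open>auto intro!: derivative_eq_intros has_real_derivative_shift_arg[OF f] f\<close>)
  then show ?thesis
    unfolding inner by (simp add: second_diff_def algebra_simps)
qed

text \<open>With f convex every quantity is nonnegative, so Tonelli applies without any prior
  integrability. Each kernel, acting on the primitive in its own variable, becomes a power, and the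
  two powers convolve against g to a constant times the integral of g over the positive half-line,
  which is \<phi> L - \<phi> 0.\<close>

lemma has_bochner_integral_second_diff_convex:
  assumes f: "\<And>x. (f has_real_derivative \<phi> x) (at x)"
    and \<phi>: "\<And>x. (\<phi> has_real_derivative g x) (at x)"
    and g: "g \<in> borel_measurable borel" "\<And>x. 0 \<le> g x" "\<And>x. L \<le> x \<Longrightarrow> g x = 0"
    and L: "0 < L" and \<alpha>: "0 < \<alpha>" "\<alpha> < 1"
  shows "has_bochner_integral (lborel \<Otimes>\<^sub>M lborel)
      (\<lambda>(v, u). marchaud_kernel \<alpha> v * marchaud_kernel (1 - \<alpha>) u * second_diff f 0 u v)
      (Beta \<alpha> (1 - \<alpha>) / (\<alpha> * (1 - \<alpha>)) * (\<phi> L - \<phi> 0))"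
proof -
  have [measurable]: "g \<in> borel_measurable borel" by (fact g)
  have cont: "continuous_on UNIV f"
    using f by (auto intro: DERIV_continuous_on has_field_derivative_at_within)
  have [measurable]: "f \<in> borel_measurable borel"
    using cont by (auto intro: borel_measurable_continuous_onI)
  have mono: "\<phi> x \<le> \<phi> y" if "x \<le> y" for x y
    using that \<phi> g(2) by (intro DERIV_nonneg_imp_nondecreasing[of x y \<phi>]) auto
  have sd_nonneg: "0 \<le> second_diff f 0 u v" if uv: "0 < u" "0 < v" for u v
  proof -
    have "f (0 + v) - f 0 \<le> f (u + v) - f u"
    proof (rule DERIV_nonneg_imp_nondecreasing[of 0 u "\<lambda>x. f (x + v) - f x"])
      fix x
      show "\<exists>y. ((\<lambda>x. f (x + v) - f x) has_real_derivative y) (at x) \<and> 0 \<le> y"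
        by (rule exI[of _ "\<phi> (x + v) - \<phi> x"])
           (use uv mono in \<open>auto intro!: derivative_eq_intros has_real_derivative_shift_arg[OF f] f\<close>)
    qed (use uv in auto)
    then show ?thesis by (simp add: second_diff_def)
  qed
  let ?h = "\<lambda>v u. marchaud_kernel \<alpha> v * marchaud_kernel (1 - \<alpha>) u * second_diff f 0 u v"
  have hm [measurable]: "(\<lambda>(v, u). ?h v u) \<in> borel_measurable (lborel \<Otimes>\<^sub>M lborel)"
    unfolding second_diff_def by measurable
  have h0: "0 \<le> ?h v u" for u v
    by (cases "0 < u \<and> 0 < v") (use sd_nonneg in \<open>auto simp: marchaud_kernel_def\<close>)
  let ?J = "\<lambda>v x. \<integral>\<^sup>+y. indicator {0<..<v} y * ennreal (g (x + y)) \<partial>lborel"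
  have Jm: "?J v \<in> borel_measurable borel" for v
    by measurable
  have "(\<integral>\<^sup>+p. ennreal (case p of (v, u) \<Rightarrow> ?h v u) \<partial>(lborel \<Otimes>\<^sub>M lborel))
      = (\<integral>\<^sup>+v. \<integral>\<^sup>+u. ennreal (?h v u) \<partial>lborel \<partial>lborel)"
    by (subst lborel.nn_integral_fst[symmetric]) auto
  also have "\<dots> = (\<integral>\<^sup>+v. ennreal (marchaud_kernel \<alpha> v) *
       (\<integral>\<^sup>+u. ennreal (marchaud_kernel (1 - \<alpha>) u) * (\<integral>\<^sup>+x. indicator {0<..<u} x * ?J v x \<partial>lborel) \<partial>lborel) \<partial>lborel)"
  proof (rule nn_integral_cong)
    fix v :: real
    show "(\<integral>\<^sup>+u. ennreal (?h v u) \<partial>lborel) = ennreal (marchaud_kernel \<alpha> v) *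
       (\<integral>\<^sup>+u. ennreal (marchaud_kernel (1 - \<alpha>) u) * (\<integral>\<^sup>+x. indicator {0<..<u} x * ?J v x \<partial>lborel) \<partial>lborel)"
    proof (cases "0 < v")
      case True
      have "ennreal (?h v u) = ennreal (marchaud_kernel \<alpha> v) * (ennreal (marchaud_kernel (1 - \<alpha>) u)
          * (\<integral>\<^sup>+x. indicator {0<..<u} x * ?J v x \<partial>lborel))" for u
      proof (cases "0 < u")
        case u: True
        show ?thesis
          by (subst nn_integral_second_diff[OF f \<phi> g(1,2) u True])
             (use sd_nonneg[OF u True] in \<open>simp add: ennreal_mult mult.assoc\<close>)
      qed (simp add: marchaud_kernel_def)
      moreover have "(\<lambda>u. ennreal (marchaud_kernel (1 - \<alpha>) u)
          * (\<integral>\<^sup>+x. indicator {0<..<u} x * ?J v x \<partial>lborel)) \<in> borel_measurable lborel"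
        by (simp add: indicator_def) measurable
      ultimately show ?thesis
        by (simp add: nn_integral_cmult)
    qed (simp add: marchaud_kernel_def)
  qed
  also have "\<dots> = (\<integral>\<^sup>+v. ennreal (marchaud_kernel \<alpha> v) *
       (\<integral>\<^sup>+x. ennreal (indicator {0<..} x * (x powr (- (1 - \<alpha>)) / (1 - \<alpha>))) * ?J v x \<partial>lborel) \<partial>lborel)"
    using \<alpha> by (subst nn_integral_kernel_primitive[OF Jm]) auto
  \<comment> \<open>The x-kernel has been reduced to a power. Exchanging x and y exposes the
    primitive in y, on which the v-kernel acts in the next step.\<close>
  also have "\<dots> = (\<integral>\<^sup>+v. ennreal (marchaud_kernel \<alpha> v) *
       (\<integral>\<^sup>+y. indicator {0<..<v} y * (\<integral>\<^sup>+x. ennreal (indicator {0<..} x * (x powr (- (1 - \<alpha>)) / (1 - \<alpha>))) * ennreal (g (x + y)) \<partial>lborel) \<partial>lborel) \<partial>lborel)"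
  proof (rule nn_integral_cong)
    fix v :: real
    let ?e = "\<lambda>x y. ennreal (indicator {0<..} x * (x powr (- (1 - \<alpha>)) / (1 - \<alpha>))) * (indicator {0<..<v} y * ennreal (g (x + y)))"
    have "(\<integral>\<^sup>+x. ennreal (indicator {0<..} x * (x powr (- (1 - \<alpha>)) / (1 - \<alpha>))) * ?J v x \<partial>lborel)
       = (\<integral>\<^sup>+x. \<integral>\<^sup>+y. ?e x y \<partial>lborel \<partial>lborel)"
      by (subst nn_integral_cmult) auto
    also have "\<dots> = (\<integral>\<^sup>+y. \<integral>\<^sup>+x. ?e x y \<partial>lborel \<partial>lborel)"
      by (rule lborel_pair.Fubini') measurable
    also have "\<dots> = (\<integral>\<^sup>+y. \<integral>\<^sup>+x. indicator {0<..<v} y * (ennreal (indicator {0<..} x * (x powr (- (1 - \<alpha>)) / (1 - \<alpha>))) * ennreal (g (x + y))) \<partial>lborel \<partial>lborel)"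
      by (simp add: mult_ac)
    also have "\<dots> = (\<integral>\<^sup>+y. indicator {0<..<v} y * (\<integral>\<^sup>+x. ennreal (indicator {0<..} x * (x powr (- (1 - \<alpha>)) / (1 - \<alpha>))) * ennreal (g (x + y)) \<partial>lborel) \<partial>lborel)"
      by (subst nn_integral_cmult) auto
    finally show "ennreal (marchaud_kernel \<alpha> v) * (\<integral>\<^sup>+x. ennreal (indicator {0<..} x * (x powr (- (1 - \<alpha>)) / (1 - \<alpha>))) * ?J v x \<partial>lborel)
      = ennreal (marchaud_kernel \<alpha> v) * (\<integral>\<^sup>+y. indicator {0<..<v} y * (\<integral>\<^sup>+x. ennreal (indicator {0<..} x * (x powr (- (1 - \<alpha>)) / (1 - \<alpha>))) * ennreal (g (x + y)) \<partial>lborel) \<partial>lborel)"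
      by simp
  qed
  also have "\<dots> = (\<integral>\<^sup>+y. ennreal (indicator {0<..} y * (y powr (- \<alpha>) / \<alpha>)) *
       (\<integral>\<^sup>+x. ennreal (indicator {0<..} x * (x powr (- (1 - \<alpha>)) / (1 - \<alpha>))) * ennreal (g (x + y)) \<partial>lborel) \<partial>lborel)"
    using \<alpha> by (intro nn_integral_kernel_primitive) auto
  also have "\<dots> = (\<integral>\<^sup>+y. ennreal (1 / (\<alpha> * (1 - \<alpha>))) * (ennreal (indicator {0<..} y * y powr (- \<alpha>)) *
       (\<integral>\<^sup>+x. ennreal (indicator {0<..} x * x powr (\<alpha> - 1)) * ennreal (g (x + y)) \<partial>lborel)) \<partial>lborel)"
  proof (rule nn_integral_cong)
    fix y :: real
    let ?X = "\<integral>\<^sup>+x. ennreal (indicator {0<..} x * x powr (\<alpha> - 1)) * ennreal (g (x + y)) \<partial>lborel"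
    have "ennreal (indicator {0<..} x * (x powr (- (1 - \<alpha>)) / (1 - \<alpha>))) =
        ennreal (1 / (1 - \<alpha>)) * ennreal (indicator {0<..} x * x powr (\<alpha> - 1))" for x :: real
      using \<alpha> by (subst ennreal_mult[symmetric]) auto
    then have "(\<integral>\<^sup>+x. ennreal (indicator {0<..} x * (x powr (- (1 - \<alpha>)) / (1 - \<alpha>))) * ennreal (g (x + y)) \<partial>lborel)
        = ennreal (1 / (1 - \<alpha>)) * ?X"
      by (subst nn_integral_cmult[symmetric]) (auto simp: mult_ac)
    moreover have "ennreal (indicator {0<..} y * (y powr (- \<alpha>) / \<alpha>)) =
        ennreal (1 / \<alpha>) * ennreal (indicator {0<..} y * y powr (- \<alpha>))"
      using \<alpha> by (subst ennreal_mult[symmetric]) auto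
    moreover have "ennreal (1 / (\<alpha> * (1 - \<alpha>))) = ennreal (1 / \<alpha>) * ennreal (1 / (1 - \<alpha>))"
      using \<alpha> by (subst ennreal_mult[symmetric]) auto
    ultimately show "ennreal (indicator {0<..} y * (y powr (- \<alpha>) / \<alpha>)) *
       (\<integral>\<^sup>+x. ennreal (indicator {0<..} x * (x powr (- (1 - \<alpha>)) / (1 - \<alpha>))) * ennreal (g (x + y)) \<partial>lborel)
       = ennreal (1 / (\<alpha> * (1 - \<alpha>))) * (ennreal (indicator {0<..} y * y powr (- \<alpha>)) * ?X)"
      by (simp add: mult_ac)
  qed
  also have "\<dots> = ennreal (1 / (\<alpha> * (1 - \<alpha>))) * (\<integral>\<^sup>+y. ennreal (indicator {0<..} y * y powr (- \<alpha>)) *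
       (\<integral>\<^sup>+x. ennreal (indicator {0<..} x * x powr (\<alpha> - 1)) * ennreal (g (x + y)) \<partial>lborel) \<partial>lborel)"
    by (rule nn_integral_cmult) measurable
  also have "\<dots> = ennreal (1 / (\<alpha> * (1 - \<alpha>))) * (ennreal (Beta \<alpha> (1 - \<alpha>)) *
       (\<integral>\<^sup>+z. indicator {0<..} z * ennreal (g z) \<partial>lborel))"
    using \<alpha> by (subst nn_integral_beta_convolution[of "\<lambda>z. ennreal (g z)"]) auto
  also have "(\<integral>\<^sup>+z. indicator {0<..} z * ennreal (g z) \<partial>lborel) = (\<integral>\<^sup>+z. ennreal (g z) * indicator {0..L} z \<partial>lborel)"
  proof (rule nn_integral_cong_AE)
    show "AE z in lborel. indicator {0<..} z * ennreal (g z) = ennreal (g z) * indicator {0..L} z"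
      using AE_lborel_singleton[of 0] AE_lborel_singleton[of L]
      by eventually_elim (use g(3) in \<open>auto simp: indicator_def\<close>)
  qed
  also have "\<dots> = ennreal (\<phi> L - \<phi> 0)"
    using L g \<phi> by (subst nn_integral_FTC_Icc[where F = \<phi>]) auto
  also have "ennreal (1 / (\<alpha> * (1 - \<alpha>))) * (ennreal (Beta \<alpha> (1 - \<alpha>)) * ennreal (\<phi> L - \<phi> 0))
      = ennreal (Beta \<alpha> (1 - \<alpha>) / (\<alpha> * (1 - \<alpha>)) * (\<phi> L - \<phi> 0))"
    using \<alpha> mono[of 0 L] L by (simp add: ennreal_mult[symmetric] Beta_def)
  finally have "(\<integral>\<^sup>+p. ennreal (case p of (v, u) \<Rightarrow> ?h v u) \<partial>(lborel \<Otimes>\<^sub>M lborel)) =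
      ennreal (Beta \<alpha> (1 - \<alpha>) / (\<alpha> * (1 - \<alpha>)) * (\<phi> L - \<phi> 0))" .
  then show ?thesis
    using h0 \<alpha> mono[of 0 L] L
    by (intro has_bochner_integral_nn_integral) (auto simp: Beta_def)
qed

subsection \<open>Second differences of averaged functions\<close>

lemma global_antiderivative:
  fixes f :: "real \<Rightarrow> real"
  assumes "continuous_on UNIV f"
  obtains F where "\<And>x. (F has_real_derivative f x) (at x)"
proof -
  have "\<exists>F. \<forall>x::real. -\<infinity> < ereal x \<longrightarrow> ereal x < \<infinity> \<longrightarrow> (F has_vector_derivative f x) (at x)"
    using assms by (intro einterval_antiderivative) (auto simp: continuous_on_eq_continuous_at)
  then show ?thesis
    using that by (auto simp: has_real_derivative_iff_has_vector_derivative)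
qed

text \<open>Splitting g into its positive and negative parts \<open>p\<close> and \<open>n\<close>
  writes f as a difference of two convex functions up to an affine one. Second differences
  annihilate affine functions, so the convex case applies to both parts.\<close>

lemma has_bochner_integral_second_diff_smooth:
  assumes f: "\<And>x. (f has_real_derivative \<phi> x) (at x)"
    and \<phi>: "\<And>x. (\<phi> has_real_derivative g x) (at x)"
    and g: "continuous_on UNIV g" "\<And>x. L \<le> x \<Longrightarrow> g x = 0"
    and L: "0 < L" and \<alpha>: "0 < \<alpha>" "\<alpha> < 1"
  shows "has_bochner_integral (lborel \<Otimes>\<^sub>M lborel)
      (\<lambda>(v, u). marchaud_kernel \<alpha> v * marchaud_kernel (1 - \<alpha>) u * second_diff f 0 u v)
      (Beta \<alpha> (1 - \<alpha>) / (\<alpha> * (1 - \<alpha>)) * (\<phi> L - \<phi> 0))"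
proof -
  define p n where "p = (\<lambda>x. max (g x) 0)" and "n = (\<lambda>x. max (- g x) 0)"
  have cp: "continuous_on UNIV p" and cn: "continuous_on UNIV n"
    unfolding p_def n_def using g(1) by (auto intro!: continuous_intros)
  obtain p1 where p1: "\<And>x. (p1 has_real_derivative p x) (at x)"
    using global_antiderivative[OF cp] by blast
  obtain n1 where n1: "\<And>x. (n1 has_real_derivative n x) (at x)"
    using global_antiderivative[OF cn] by blast
  have cp1: "continuous_on UNIV p1" and cn1: "continuous_on UNIV n1"
    using p1 n1 by (auto intro: DERIV_continuous_on has_field_derivative_at_within)
  obtain p2 where p2: "\<And>x. (p2 has_real_derivative p1 x) (at x)"
    using global_antiderivative[OF cp1] by blast
  obtain n2 where n2: "\<And>x. (n2 has_real_derivative n1 x) (at x)"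
    using global_antiderivative[OF cn1] by blast
  have gpn: "g x = p x - n x" for x by (auto simp: p_def n_def)
  have "((\<lambda>x. \<phi> x - p1 x + n1 x) has_real_derivative 0) (at x)" for x
    by (auto intro!: derivative_eq_intros \<phi> p1 n1 simp: gpn)
  then have c1: "\<phi> x - p1 x + n1 x = \<phi> 0 - p1 0 + n1 0" for x
    using DERIV_isconst_all[of "\<lambda>x. \<phi> x - p1 x + n1 x" x 0] by blast
  define c where "c = \<phi> 0 - p1 0 + n1 0"
  have "((\<lambda>x. f x - p2 x + n2 x - c * x) has_real_derivative 0) (at x)" for x
    using c1[of x] by (auto intro!: derivative_eq_intros f p2 n2 simp: c_def)
  then have c2: "f x - p2 x + n2 x - c * x = f 0 - p2 0 + n2 0" for x
    using DERIV_isconst_all[of "\<lambda>x. f x - p2 x + n2 x - c * x" x 0] by auto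
  have fx: "f x = p2 x - n2 x + c * x + (f 0 - p2 0 + n2 0)" for x
    using c2[of x] by linarith
  have sd: "second_diff f 0 u v = second_diff p2 0 u v - second_diff n2 0 u v" for u v
    unfolding second_diff_def fx[of u] fx[of v] fx[of "0 + u"] fx[of "0 + v"] fx[of "0 + u + v"]
    by (simp add: algebra_simps)
  let ?c = "Beta \<alpha> (1 - \<alpha>) / (\<alpha> * (1 - \<alpha>))"
  have "has_bochner_integral (lborel \<Otimes>\<^sub>M lborel)
      (\<lambda>z. (case z of (v, u) \<Rightarrow> marchaud_kernel \<alpha> v * marchaud_kernel (1 - \<alpha>) u * second_diff p2 0 u v)
         - (case z of (v, u) \<Rightarrow> marchaud_kernel \<alpha> v * marchaud_kernel (1 - \<alpha>) u * second_diff n2 0 u v))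
      (?c * (p1 L - p1 0) - ?c * (n1 L - n1 0))"
    using cp cn g(2)
    by (intro has_bochner_integral_diff has_bochner_integral_second_diff_convex[OF p2 p1 _ _ _ L \<alpha>]
          has_bochner_integral_second_diff_convex[OF n2 n1 _ _ _ L \<alpha>])
       (auto simp: p_def n_def intro: borel_measurable_continuous_onI)
  also have "?c * (p1 L - p1 0) - ?c * (n1 L - n1 0) = ?c * (\<phi> L - \<phi> 0)"
    using c1[of L] by (subst right_diff_distrib[symmetric]) simp
  finally show ?thesis
    by (simp add: sd case_prod_unfold right_diff_distrib)
qed

text \<open>The second difference of an average of f is an average of second differences of f at
  base points between w and w + e, and the mean value theorem picks one of them. This is why a bound
  is required at every base point w \<ge> 0, although the kernel integral only looks at 0.\<close>

lemma second_diff_average_le: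
  assumes g: "\<And>x. (g has_real_derivative f x) (at x)"
    and k: "\<And>w. 0 \<le> w \<Longrightarrow> \<bar>second_diff f w u v\<bar> \<le> k" and "0 < e" "0 \<le> w"
  shows "\<bar>second_diff (\<lambda>x. (g (x + e) - g x) / e) w u v\<bar> \<le> k"
proof -
  define H where "H = (\<lambda>x. g (w + x) - g ((w + u) + x) - g ((w + v) + x) + g ((w + u + v) + x))"
  have H: "(H has_real_derivative second_diff f (w + x) u v) (at x)" for x
    unfolding H_def
    by (rule derivative_eq_intros has_real_derivative_shift_arg(2)[OF g] refl)+
       (simp add: second_diff_def add_ac)
  obtain z where z: "0 < z" "z < e" "H e - H 0 = (e - 0) * second_diff f (w + z) u v"
    using MVT2[OF \<open>0 < e\<close>, of H "\<lambda>x. second_diff f (w + x) u v"] H by blast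
  have "second_diff (\<lambda>x. (g (x + e) - g x) / e) w u v = (H e - H 0) / e"
    by (simp add: second_diff_def H_def diff_divide_distrib add_divide_distrib add_ac)
  also have "\<dots> = second_diff f (w + z) u v"
    using z \<open>0 < e\<close> by simp
  finally show ?thesis using k[of "w + z"] z \<open>0 \<le> w\<close> by simp
qed

section \<open>The kernel integral as a functional of the moment function\<close>

definition kernel_mean :: "real \<Rightarrow> (real \<Rightarrow> real) \<Rightarrow> real" where
  "kernel_mean \<alpha> f = (\<integral>(v, u). marchaud_kernel \<alpha> v * marchaud_kernel (1 - \<alpha>) u * second_diff f 0 u v
     \<partial>(lborel \<Otimes>\<^sub>M lborel))"

lemma has_bochner_integral_product_kernel:
  assumes "has_bochner_integral lborel f x" "has_bochner_integral lborel g y"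
    and nonneg: "\<And>x. 0 \<le> f x" "\<And>x. 0 \<le> g x"
  shows "has_bochner_integral (lborel \<Otimes>\<^sub>M lborel) (\<lambda>(v, u). f v * g u :: real) (x * y)"
proof -
  have f: "integrable lborel f" "integral\<^sup>L lborel f = x" and g: "integrable lborel g" "integral\<^sup>L lborel g = y"
    using assms by (auto simp: has_bochner_integral_iff)
  have [measurable]: "f \<in> borel_measurable lborel" "g \<in> borel_measurable lborel"
    using f g by auto
  have I: "integrable (lborel \<Otimes>\<^sub>M lborel) (\<lambda>(v, u). f v * g u)"
    by (rule lborel_pair.Fubini_integrable) (use f g in \<open>auto simp: abs_mult\<close>)
  moreover have "(\<integral>z. (case z of (v, u) \<Rightarrow> f v * g u) \<partial>(lborel \<Otimes>\<^sub>M lborel)) = x * y"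
    by (subst lborel_pair.integral_fst'[OF I, symmetric]) (use f g in simp)
  ultimately show ?thesis by (simp add: has_bochner_integral_iff)
qed

text \<open>All base points w \<ge> 0 are included so that averaging over forward windows preserves
  the property with the same constant. Truncation at L makes the bound integrable against both
  kernels at infinity.\<close>

definition second_diff_bound :: "real \<Rightarrow> real \<Rightarrow> real \<Rightarrow> real \<Rightarrow> (real \<Rightarrow> real) \<Rightarrow> bool" where
  "second_diff_bound \<tau> \<beta> L C f \<longleftrightarrow>
     (\<forall>w\<ge>0. \<forall>u>0. \<forall>v>0. \<bar>second_diff f w u v\<bar> \<le> C * min u L powr \<tau> * min v L powr \<beta>)"

lemma has_bochner_integral_majorant:
  assumes "0 < \<alpha>" "\<alpha> < \<beta>" "\<alpha> < 1" "1 - \<alpha> < \<tau>" "0 < L"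
  shows "has_bochner_integral (lborel \<Otimes>\<^sub>M lborel)
    (\<lambda>(v, u). (marchaud_kernel \<alpha> v * min v L powr \<beta>) * (marchaud_kernel (1 - \<alpha>) u * min u L powr \<tau>))
    (truncated_kernel_mass \<alpha> \<beta> L * truncated_kernel_mass (1 - \<alpha>) \<tau> L)"
  using assms
  by (intro has_bochner_integral_product_kernel has_bochner_integral_truncated_kernel) auto

lemma kernel_mean_pointwise:
  assumes "second_diff_bound \<tau> \<beta> L C f" "0 \<le> C"
  shows "\<bar>marchaud_kernel \<alpha> v * marchaud_kernel (1 - \<alpha>) u * second_diff f 0 u v\<bar>
    \<le> C * ((marchaud_kernel \<alpha> v * min v L powr \<beta>) * (marchaud_kernel (1 - \<alpha>) u * min u L powr \<tau>))"
proof (cases "0 < u \<and> 0 < v")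
  case True
  then have "\<bar>second_diff f 0 u v\<bar> \<le> C * min u L powr \<tau> * min v L powr \<beta>"
    using assms by (auto simp: second_diff_bound_def)
  then have "marchaud_kernel \<alpha> v * marchaud_kernel (1 - \<alpha>) u * \<bar>second_diff f 0 u v\<bar>
     \<le> marchaud_kernel \<alpha> v * marchaud_kernel (1 - \<alpha>) u * (C * min u L powr \<tau> * min v L powr \<beta>)"
    by (intro mult_left_mono) auto
  then show ?thesis by (simp add: abs_mult mult_ac)
qed (auto simp: marchaud_kernel_def)

text \<open>The dependence on L is kept explicit: with L the length of the interval, it later yields
  the Hoelder exponent of the integral in its upper limit.\<close>

lemma kernel_mean_le:
  assumes f: "second_diff_bound \<tau> \<beta> L C f" "0 \<le> C"
    and "0 < \<alpha>" "\<alpha> < \<beta>" "\<alpha> < 1" "1 - \<alpha> < \<tau>" "0 < L"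
  shows "\<bar>kernel_mean \<alpha> f\<bar> \<le> C * (truncated_kernel_mass \<alpha> \<beta> L * truncated_kernel_mass (1 - \<alpha>) \<tau> L)"
proof -
  note m = has_bochner_integral_mult_right[OF has_bochner_integral_majorant[OF assms(3-7)], of C]
  have "norm (kernel_mean \<alpha> f) \<le> (\<integral>z. C * (case z of (v, u) \<Rightarrow> (marchaud_kernel \<alpha> v * min v L powr \<beta>) * (marchaud_kernel (1 - \<alpha>) u * min u L powr \<tau>)) \<partial>(lborel \<Otimes>\<^sub>M lborel))"
    unfolding kernel_mean_def
    using m kernel_mean_pointwise[OF f] f(2)
    by (intro order.trans[OF integral_norm_bound] integral_mono')
       (auto simp: has_bochner_integral_iff split: prod.splits)
  also have "\<dots> = C * (truncated_kernel_mass \<alpha> \<beta> L * truncated_kernel_mass (1 - \<alpha>) \<tau> L)"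
    using m by (simp add: has_bochner_integral_iff)
  finally show ?thesis by simp
qed

text \<open>One constant C for the whole sequence supplies a common integrable majorant, so
  pointwise convergence suffices.\<close>

lemma kernel_mean_tendsto:
  assumes bnd: "\<And>n. second_diff_bound \<tau> \<beta> L C (f n)" "0 \<le> C"
    and "0 < \<alpha>" "\<alpha> < \<beta>" "\<alpha> < 1" "1 - \<alpha> < \<tau>" "0 < L"
    and lim: "\<And>w. (\<lambda>n. f n w) \<longlonglongrightarrow> h w"
    and meas: "\<And>n. f n \<in> borel_measurable borel" "h \<in> borel_measurable borel"
  shows "(\<lambda>n. kernel_mean \<alpha> (f n)) \<longlonglongrightarrow> kernel_mean \<alpha> h"
  unfolding kernel_mean_def
proof (rule integral_dominated_convergence)
  have [measurable]: "f n \<in> borel_measurable borel" "h \<in> borel_measurable borel" for n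
    by (fact meas)+
  show "(\<lambda>(v, u). marchaud_kernel \<alpha> v * marchaud_kernel (1 - \<alpha>) u * second_diff h 0 u v)
      \<in> borel_measurable (lborel \<Otimes>\<^sub>M lborel)"
    unfolding second_diff_def by measurable
  show "(\<lambda>(v, u). marchaud_kernel \<alpha> v * marchaud_kernel (1 - \<alpha>) u * second_diff (f n) 0 u v)
      \<in> borel_measurable (lborel \<Otimes>\<^sub>M lborel)" for n
    unfolding second_diff_def by measurable
  show "integrable (lborel \<Otimes>\<^sub>M lborel) (\<lambda>z. C * (case z of (v, u) \<Rightarrow> (marchaud_kernel \<alpha> v * min v L powr \<beta>) * (marchaud_kernel (1 - \<alpha>) u * min u L powr \<tau>)))"
    using has_bochner_integral_majorant[OF assms(3-7)]
    by (intro integrable_mult_right) (rule integrable.intros)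
  show "AE z in lborel \<Otimes>\<^sub>M lborel. (\<lambda>n. case z of (v, u) \<Rightarrow> marchaud_kernel \<alpha> v * marchaud_kernel (1 - \<alpha>) u * second_diff (f n) 0 u v)
      \<longlonglongrightarrow> (case z of (v, u) \<Rightarrow> marchaud_kernel \<alpha> v * marchaud_kernel (1 - \<alpha>) u * second_diff h 0 u v)"
    by (rule AE_I2) (auto simp: second_diff_def intro!: tendsto_intros lim split: prod.splits)
  show "AE z in lborel \<Otimes>\<^sub>M lborel. norm (case z of (v, u) \<Rightarrow> marchaud_kernel \<alpha> v * marchaud_kernel (1 - \<alpha>) u * second_diff (f n) 0 u v)
     \<le> C * (case z of (v, u) \<Rightarrow> (marchaud_kernel \<alpha> v * min v L powr \<beta>) * (marchaud_kernel (1 - \<alpha>) u * min u L powr \<tau>))" for n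
    using kernel_mean_pointwise[OF bnd] by (intro AE_I2) (auto split: prod.splits)
qed

lemma real_derivative_quotient_tendsto:
  assumes "(g has_real_derivative d) (at (x::real))" "\<And>n. e n \<noteq> 0" "e \<longlonglongrightarrow> 0"
  shows "(\<lambda>n. (g (x + e n) - g x) / e n) \<longlonglongrightarrow> d"
proof -
  have "((\<lambda>h. (g (x + h) - g x) / h) \<longlongrightarrow> d) (at 0)"
    using assms(1) by (simp add: DERIV_def)
  then show ?thesis
    by (rule filterlim_compose) (use assms in \<open>auto simp: filterlim_at\<close>)
qed

text \<open>Averaging \<open>f\<close> over windows of length \<open>\<delta>\<close> and \<open>\<epsilon>\<close> makes it twice differentiable while
  keeping the bound on second differences; then \<open>\<epsilon>\<close> and \<open>\<delta>\<close> tend to \<open>0\<close>, in this order.\<close>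

lemma kernel_mean_eq_difference_quotient_limit:
  assumes bnd: "second_diff_bound \<tau> \<beta> L C f" "0 \<le> C"
    and \<alpha>: "0 < \<alpha>" "\<alpha> < \<beta>" "\<alpha> < 1" "1 - \<alpha> < \<tau>" and L: "0 < L"
    and f: "continuous_on UNIV f" "\<And>w. L \<le> w \<Longrightarrow> f w = 0"
    and d: "\<And>n. 0 < d n" "d \<longlonglongrightarrow> 0"
  shows "(\<lambda>n. Beta \<alpha> (1 - \<alpha>) / (\<alpha> * (1 - \<alpha>)) * (- ((f (d n) - f 0) / d n)))
     \<longlonglongrightarrow> kernel_mean \<alpha> f"
proof -
  let ?c = "Beta \<alpha> (1 - \<alpha>) / (\<alpha> * (1 - \<alpha>))"
  obtain F1 where F1: "\<And>x. (F1 has_real_derivative f x) (at x)"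
    using global_antiderivative[OF f(1)] by blast
  have cF1: "continuous_on UNIV F1"
    using F1 by (auto intro: DERIV_continuous_on has_field_derivative_at_within)
  obtain F2 where F2: "\<And>x. (F2 has_real_derivative F1 x) (at x)"
    using global_antiderivative[OF cF1] by blast
  have cF2: "continuous_on UNIV F2"
    using F2 by (auto intro: DERIV_continuous_on has_field_derivative_at_within)
  have F1L: "F1 x = F1 L" if "L \<le> x" for x
  proof (cases "x = L")
    case False
    then have "L < x" using that by simp
    moreover have "continuous_on {L..x} F1" using cF1 by (rule continuous_on_subset) simp
    moreover have "(F1 has_real_derivative 0) (at y)" if "L < y" for y
      using F1[of y] f(2)[of y] that by simp
    ultimately show ?thesis
      using DERIV_isconst2[of L x F1 x] by simp
  qed simp
  \<comment> \<open>\<open>M \<delta>\<close> is the forward average of f over a window of length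
    \<delta>, and \<open>N \<delta>\<close> is an antiderivative of it. Averaging once more over
    \<epsilon> is thus a difference quotient of \<open>N \<delta>\<close>, with a continuous second
    derivative.\<close>
  define M where "M = (\<lambda>\<delta> x. (F1 (x + \<delta>) - F1 x) / \<delta>)"
  define N where "N = (\<lambda>\<delta> x. (F2 (x + \<delta>) - F2 x) / \<delta>)"
  have cont: "continuous_on UNIV (\<lambda>x. g (x + \<delta>))" if "continuous_on UNIV g" for g :: "real \<Rightarrow> real" and \<delta>
    by (rule continuous_on_compose2[OF that]) (auto intro!: continuous_intros)
  have dN: "(N \<delta> has_real_derivative M \<delta> x) (at x)" for \<delta> x
    unfolding N_def M_def
    by (cases "\<delta> = 0") (auto intro!: derivative_eq_intros has_real_derivative_shift_arg[OF F2] F2)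
  have dM: "(M \<delta> has_real_derivative (f (x + \<delta>) - f x) / \<delta>) (at x)" for \<delta> x
    unfolding M_def
    by (cases "\<delta> = 0") (auto intro!: derivative_eq_intros has_real_derivative_shift_arg[OF F1] F1)
  have bM: "second_diff_bound \<tau> \<beta> L C (M \<delta>)" if "0 < \<delta>" for \<delta>
    unfolding second_diff_bound_def M_def
    using bnd(1) that by (auto simp: second_diff_bound_def intro!: second_diff_average_le[OF F1])
  have bMM: "second_diff_bound \<tau> \<beta> L C (\<lambda>x. (N \<delta> (x + \<epsilon>) - N \<delta> x) / \<epsilon>)" if "0 < \<delta>" "0 < \<epsilon>" for \<delta> \<epsilon>
    unfolding second_diff_bound_def
    using bM[OF that(1)] that by (auto simp: second_diff_bound_def intro!: second_diff_average_le[OF dN])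
  have mean: "kernel_mean \<alpha> (\<lambda>x. (N \<delta> (x + \<epsilon>) - N \<delta> x) / \<epsilon>) = ?c * (- ((M \<delta> (0 + \<epsilon>) - M \<delta> 0) / \<epsilon>))"
    if "0 < \<delta>" "0 < \<epsilon>" for \<delta> \<epsilon>
  proof -
    let ?\<phi> = "\<lambda>x. (M \<delta> (x + \<epsilon>) - M \<delta> x) / \<epsilon>"
    let ?g = "\<lambda>x. ((f (x + \<epsilon> + \<delta>) - f (x + \<epsilon>)) / \<delta> - (f (x + \<delta>) - f x) / \<delta>) / \<epsilon>"
    have "has_bochner_integral (lborel \<Otimes>\<^sub>M lborel)
      (\<lambda>(v, u). marchaud_kernel \<alpha> v * marchaud_kernel (1 - \<alpha>) u * second_diff (\<lambda>x. (N \<delta> (x + \<epsilon>) - N \<delta> x) / \<epsilon>) 0 u v)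
      (?c * (?\<phi> L - ?\<phi> 0))"
    proof (rule has_bochner_integral_second_diff_smooth[where g = ?g])
      show "((\<lambda>x. (N \<delta> (x + \<epsilon>) - N \<delta> x) / \<epsilon>) has_real_derivative ?\<phi> x) (at x)" for x
        using that by (auto intro!: derivative_eq_intros has_real_derivative_shift_arg[OF dN] dN)
      show "(?\<phi> has_real_derivative ?g x) (at x)" for x
        using that by (auto intro!: derivative_eq_intros has_real_derivative_shift_arg[OF dM] dM)
      show "continuous_on UNIV ?g"
        using that by (intro continuous_intros cont f(1)) (auto simp: add.assoc intro!: cont f(1))
      show "?g x = 0" if "L \<le> x" for x
        using f(2) \<open>0 < \<delta>\<close> \<open>0 < \<epsilon>\<close> that by simp
    qed (use L \<alpha> in auto)
    \<comment> \<open>From L on f vanishes and \<open>F1\<close> is constant, so only the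
      contribution at 0 remains.\<close>
    moreover have "?\<phi> L = 0"
      using F1L[of "L + \<epsilon> + \<delta>"] F1L[of "L + \<epsilon>"] F1L[of "L + \<delta>"] that by (simp add: M_def)
    ultimately show ?thesis
      unfolding kernel_mean_def by (simp add: has_bochner_integral_iff)
  qed
  have contM: "continuous_on UNIV (M \<delta>)" for \<delta>
    by (rule DERIV_continuous_on[OF has_field_derivative_at_within[OF dM]])
  have contN: "continuous_on UNIV (N \<delta>)" for \<delta>
    by (rule DERIV_continuous_on[OF has_field_derivative_at_within[OF dN]])
  have d0: "d n \<noteq> 0" for n using d(1)[of n] by simp
  \<comment> \<open>The limit \<epsilon> -> 0 is taken on both sides: domination handles the kernel
    means, and the right-hand side tends to the derivative of \<open>M \<delta>\<close> at 0, which
    is the difference quotient of f.\<close>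
  have meanM: "kernel_mean \<alpha> (M \<delta>) = ?c * (- ((f \<delta> - f 0) / \<delta>))" if \<delta>: "0 < \<delta>" for \<delta>
  proof (rule LIMSEQ_unique)
    show "(\<lambda>n. kernel_mean \<alpha> (\<lambda>x. (N \<delta> (x + d n) - N \<delta> x) / d n)) \<longlonglongrightarrow> kernel_mean \<alpha> (M \<delta>)"
    proof (rule kernel_mean_tendsto[OF bMM[OF \<delta> d(1)] bnd(2) \<alpha> L])
      show "(\<lambda>n. (N \<delta> (w + d n) - N \<delta> w) / d n) \<longlonglongrightarrow> M \<delta> w" for w
        by (rule real_derivative_quotient_tendsto[OF dN d0 d(2)])
      show "(\<lambda>x. (N \<delta> (x + d n) - N \<delta> x) / d n) \<in> borel_measurable borel" for n
        using d0 by (intro borel_measurable_continuous_onI continuous_intros cont contN) auto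
      show "M \<delta> \<in> borel_measurable borel"
        by (intro borel_measurable_continuous_onI contM)
    qed
    show "(\<lambda>n. kernel_mean \<alpha> (\<lambda>x. (N \<delta> (x + d n) - N \<delta> x) / d n)) \<longlonglongrightarrow> ?c * (- ((f \<delta> - f 0) / \<delta>))"
      unfolding mean[OF \<delta> d(1)]
      using real_derivative_quotient_tendsto[OF dM[of \<delta> 0] d0 d(2)]
      by (intro tendsto_mult_left tendsto_minus) simp
  qed
  \<comment> \<open>By \<open>meanM\<close> the kernel mean of \<open>M (d n)\<close> is a constant
    times a difference quotient of f. Convergence of the means is therefore convergence of the
    quotients; f is not assumed differentiable at 0.\<close>
  have "(\<lambda>n. kernel_mean \<alpha> (M (d n))) \<longlonglongrightarrow> kernel_mean \<alpha> f"
  proof (rule kernel_mean_tendsto[OF bM[OF d(1)] bnd(2) \<alpha> L])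
    show "(\<lambda>n. M (d n) w) \<longlonglongrightarrow> f w" for w
      unfolding M_def by (rule real_derivative_quotient_tendsto[OF F1 d0 d(2)])
    show "M (d n) \<in> borel_measurable borel" for n
      by (intro borel_measurable_continuous_onI contM)
    show "f \<in> borel_measurable borel"
      by (intro borel_measurable_continuous_onI f(1))
  qed
  then show ?thesis by (simp only: meanM[OF d(1)])
qed

subsection \<open>Functions with jointly Hoelder continuous increments\<close>

lemma holder_imp_continuous_on:
  fixes f :: "real \<Rightarrow> real"
  assumes h: "\<And>x y. \<bar>f x - f y\<bar> \<le> M * \<bar>x - y\<bar> powr \<sigma>" and \<sigma>: "0 < \<sigma>"
  shows "continuous_on UNIV f"
  unfolding continuous_on_def
proof
  fix x :: real
  have "((\<lambda>y. \<bar>y - x\<bar>) \<longlongrightarrow> \<bar>x - x\<bar>) (at x)"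
    by (rule tendsto_rabs[OF tendsto_diff[OF tendsto_ident_at tendsto_const]])
  then have "((\<lambda>y. \<bar>y - x\<bar> powr \<sigma>) \<longlongrightarrow> \<bar>x - x\<bar> powr \<sigma>) (at x)"
    by (rule tendsto_powr'[OF _ tendsto_const]) (simp add: \<sigma>)
  then have "((\<lambda>y. M * \<bar>y - x\<bar> powr \<sigma>) \<longlongrightarrow> M * 0) (at x)"
    by (intro tendsto_mult tendsto_const) simp
  then have "((\<lambda>y. M * \<bar>y - x\<bar> powr \<sigma>) \<longlongrightarrow> 0) (at x)"
    by simp
  then have "((\<lambda>y. f y - f x) \<longlongrightarrow> 0) (at x)"
    by (rule Lim_null_comparison[OF always_eventually, rotated]) (use h in simp)
  then show "(f \<longlongrightarrow> f x) (at x)"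
    by (rule iffD2[OF Lim_null])
qed

lemma integrable_indicator_Icc [simp]: "integrable lborel (indicator {a..c::real} :: real \<Rightarrow> real)"
  by (rule integrable_real_indicator) (auto simp: emeasure_lborel_Icc_eq)

lemma integral_diff_diff:
  fixes f g h k :: "'a \<Rightarrow> real"
  assumes "integrable M f" "integrable M g" "integrable M h" "integrable M k"
  shows "(\<integral>x. f x - g x - (h x - k x) \<partial>M) = (\<integral>x. f x \<partial>M) - (\<integral>x. g x \<partial>M) - ((\<integral>x. h x \<partial>M) - (\<integral>x. k x \<partial>M))"
  using assms by simp

text \<open>The function \<open>P\<close> of the overview. Freezing the first argument at c achieves
  the extension by zero and, s -> min s c being 1-Lipschitz, keeps the Hoelder bounds.\<close>

definition stopped_increment :: "(real \<Rightarrow> real \<Rightarrow> real) \<Rightarrow> real \<Rightarrow> real \<Rightarrow> real \<Rightarrow> real" where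
  "stopped_increment W c s t = W (min s c) t - W c t"

text \<open>The function \<open>A\<close> of the overview. For w \<ge> 0 its increment from 0 is the
  integral over {a..c} of the forward increments of W, frozen at c.\<close>

definition forward_moment :: "(real \<Rightarrow> real \<Rightarrow> real) \<Rightarrow> real \<Rightarrow> real \<Rightarrow> real \<Rightarrow> real" where
  "forward_moment W a c w = (\<integral>t. indicator {a..c} t * stopped_increment W c (t + w) t \<partial>lborel)"

text \<open>The bracket of the triple integral, with an extra shift w of the first argument so that
  its t-integral is a second difference based at w. The conditional is the extension by zero to
  second arguments below a.\<close>

definition corner_increment ::
    "(real \<Rightarrow> real \<Rightarrow> real) \<Rightarrow> real \<Rightarrow> real \<Rightarrow> real \<Rightarrow> real \<Rightarrow> real \<Rightarrow> real \<Rightarrow> real" where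
  "corner_increment W a c w t v u =
     stopped_increment W c (t + w) t - stopped_increment W c (t + w + u) t
     - (if t - v < a then 0
        else stopped_increment W c (t + w) (t - v) - stopped_increment W c (t + w + u) (t - v))"

text \<open>Abstracts weight times integrator to a function with bounds on the whole plane, which
  removes all membership conditions from the shifted arguments. The restriction \<beta> \<le> 1
  serves the boundary strip near a, whose contribution is linear in its width.\<close>

locale joint_holder =
  fixes W :: "real \<Rightarrow> real \<Rightarrow> real" and \<tau> \<beta> K :: real
  assumes W_measurable: "(\<lambda>(s, t). W s t) \<in> borel_measurable (borel \<Otimes>\<^sub>M borel)"
    and W_first: "\<And>s s' t. \<bar>W s t - W s' t\<bar> \<le> K * \<bar>s - s'\<bar> powr \<tau>"
    and W_rect: "\<And>s s' t t'. \<bar>W s t - W s' t - W s t' + W s' t'\<bar>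
      \<le> K * \<bar>s - s'\<bar> powr \<tau> * \<bar>t - t'\<bar> powr \<beta>"
    and K_nonneg: "0 \<le> K" and \<tau>_pos: "0 < \<tau>" and \<beta>_pos: "0 < \<beta>" and \<beta>_le_1: "\<beta> \<le> 1"
begin

lemma measurable_W [measurable (raw)]:
  assumes "f \<in> borel_measurable M" "g \<in> borel_measurable M"
  shows "(\<lambda>x. W (f x) (g x)) \<in> borel_measurable M"
proof -
  have "(\<lambda>x. (f x, g x)) \<in> M \<rightarrow>\<^sub>M borel \<Otimes>\<^sub>M borel"
    using assms by measurable
  from measurable_compose[OF this W_measurable] show ?thesis by simp
qed

lemma measurable_stopped_increment [measurable (raw)]:
  assumes "f \<in> borel_measurable M" "g \<in> borel_measurable M"
  shows "(\<lambda>x. stopped_increment W c (f x) (g x)) \<in> borel_measurable M"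
  unfolding stopped_increment_def using assms by measurable

lemma stopped_increment_first:
  "\<bar>stopped_increment W c s t - stopped_increment W c s' t\<bar> \<le> K * \<bar>s - s'\<bar> powr \<tau>"
proof -
  have "\<bar>stopped_increment W c s t - stopped_increment W c s' t\<bar> \<le> K * \<bar>min s c - min s' c\<bar> powr \<tau>"
    using W_first[of "min s c" t "min s' c"] by (simp add: stopped_increment_def)
  also have "\<dots> \<le> K * \<bar>s - s'\<bar> powr \<tau>"
    using K_nonneg \<tau>_pos by (intro mult_left_mono powr_mono2) (auto simp: min_def)
  finally show ?thesis .
qed

lemma stopped_increment_rect:
  "\<bar>stopped_increment W c s t - stopped_increment W c s' t
     - (stopped_increment W c s t' - stopped_increment W c s' t')\<bar>
   \<le> K * \<bar>min s c - min s' c\<bar> powr \<tau> * \<bar>t - t'\<bar> powr \<beta>"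
  using W_rect[of "min s c" t "min s' c" t'] by (simp add: stopped_increment_def algebra_simps)

lemma stopped_increment_beyond: "c \<le> s \<Longrightarrow> stopped_increment W c s t = 0"
  by (simp add: stopped_increment_def)

text \<open>If t - v stays above a, the rectangular bound gives a power of v. Otherwise only the
  increment in the first argument survives, and no power of v is gained.\<close>

lemma corner_increment_le:
  assumes t: "a \<le> t" "t \<le> c" and uvw: "0 < u" "0 < v" "0 \<le> w"
  shows "\<bar>corner_increment W a c w t v u\<bar>
    \<le> K * min u (c - a) powr \<tau> * (if v \<le> t - a then v powr \<beta> else 1)"
proof -
  let ?d = "\<bar>min (t + w) c - min (t + w + u) c\<bar>"
  have d: "?d powr \<tau> \<le> min u (c - a) powr \<tau>"
    using \<tau>_pos t uvw by (intro powr_mono2) auto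
  show ?thesis
  proof (cases "v \<le> t - a")
    case True
    then have "\<bar>corner_increment W a c w t v u\<bar> \<le> K * ?d powr \<tau> * \<bar>t - (t - v)\<bar> powr \<beta>"
      using stopped_increment_rect[of c "t + w" t "t + w + u" "t - v"]
      by (simp add: corner_increment_def)
    also have "\<dots> \<le> K * min u (c - a) powr \<tau> * v powr \<beta>"
      using d K_nonneg uvw by (auto intro!: mult_right_mono mult_left_mono)
    finally show ?thesis using True by simp
  next
    case False
    then have "\<bar>corner_increment W a c w t v u\<bar> \<le> K * ?d powr \<tau>"
      using W_first[of "min (t + w) c" t "min (t + w + u) c"]
      by (simp add: corner_increment_def stopped_increment_def)
    also have "\<dots> \<le> K * min u (c - a) powr \<tau>"
      using d K_nonneg by (intro mult_left_mono)
    finally show ?thesis using False by simp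
  qed
qed

lemma measurable_corner_increment [measurable (raw)]:
  assumes [measurable]: "f \<in> borel_measurable M" "g \<in> borel_measurable M" "h \<in> borel_measurable M"
  shows "(\<lambda>x. corner_increment W a c w (f x) (g x) (h x)) \<in> borel_measurable M"
  unfolding corner_increment_def by measurable

text \<open>The missing power of v is recovered by integration: the bad t fill a strip at a of
  length at most \<open>mv = min v (c - a)\<close>, and
  \<open>mv \<le> mv powr \<beta> * (c - a) powr (1 - \<beta>)\<close> because \<beta> \<le> 1. Bulk
  and strip account for the two summands of the constant.\<close>

lemma
  assumes ac: "a < c" and uvw: "0 < u" "0 < v" "0 \<le> w"
  shows integrable_corner_increment:
      "integrable lborel (\<lambda>t. indicator {a..c} t * corner_increment W a c w t v u)"
    and integral_abs_corner_increment_le: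
      "(\<integral>t. \<bar>indicator {a..c} t * corner_increment W a c w t v u\<bar> \<partial>lborel)
        \<le> K * (c - a + (c - a) powr (1 - \<beta>)) * min u (c - a) powr \<tau> * min v (c - a) powr \<beta>"
proof -
  define L where "L = c - a"
  have L: "0 < L" using ac by (simp add: L_def)
  define mu where "mu = min u L"
  define mv where "mv = min v L"
  have mv: "0 < mv" "mv \<le> L" using uvw L by (auto simp: mv_def)
  let ?B = "\<lambda>t. K * mu powr \<tau> * (indicator {a..c} t * mv powr \<beta> + indicator {a..a + mv} t)"
  have le: "\<bar>indicator {a..c} t * corner_increment W a c w t v u\<bar> \<le> ?B t" for t
  proof (cases "t \<in> {a..c}")
    case True
    then have t: "a \<le> t" "t \<le> c" by auto
    have "(if v \<le> t - a then v powr \<beta> else 1) \<le> mv powr \<beta> + indicator {a..a + mv} t"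
    proof (cases "v \<le> t - a")
      case True
      then have "mv = v" using t by (auto simp: mv_def L_def)
      then show ?thesis using True by simp
    next
      case False
      then have "t \<in> {a..a + mv}" using t by (auto simp: mv_def L_def)
      then show ?thesis using False by simp
    qed
    then have "K * mu powr \<tau> * (if v \<le> t - a then v powr \<beta> else 1)
        \<le> K * mu powr \<tau> * (mv powr \<beta> + indicator {a..a + mv} t)"
      using K_nonneg by (intro mult_left_mono) auto
    then show ?thesis
      using corner_increment_le[OF t uvw] True by (simp add: mu_def L_def)
  qed (use K_nonneg in auto)
  have B: "integrable lborel ?B"
    by (intro integrable_mult_right Bochner_Integration.integrable_add integrable_mult_left) auto
  show "integrable lborel (\<lambda>t. indicator {a..c} t * corner_increment W a c w t v u)"
    by (rule Bochner_Integration.integrable_bound[OF B])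
       (use le in \<open>auto intro!: AE_I2 order.trans[OF _ abs_ge_self]\<close>)
  have "(\<integral>t. \<bar>indicator {a..c} t * corner_increment W a c w t v u\<bar> \<partial>lborel) \<le> (\<integral>t. ?B t \<partial>lborel)"
    by (rule integral_mono'[OF B le]) (use K_nonneg in auto)
  also have "\<dots> = K * mu powr \<tau> * (L * mv powr \<beta> + mv)"
    using ac mv by (simp add: L_def)
  also have "\<dots> \<le> K * mu powr \<tau> * (L * mv powr \<beta> + mv powr \<beta> * L powr (1 - \<beta>))"
  proof -
    have "mv = mv powr \<beta> * mv powr (1 - \<beta>)"
      using mv by (simp add: powr_add[symmetric])
    also have "\<dots> \<le> mv powr \<beta> * L powr (1 - \<beta>)"
      using mv \<beta>_le_1 by (intro mult_left_mono powr_mono2) auto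
    finally show ?thesis
      using K_nonneg by (intro mult_left_mono add_left_mono) auto
  qed
  also have "\<dots> = K * (L + L powr (1 - \<beta>)) * mu powr \<tau> * mv powr \<beta>"
    by (simp add: algebra_simps)
  finally show "(\<integral>t. \<bar>indicator {a..c} t * corner_increment W a c w t v u\<bar> \<partial>lborel)
        \<le> K * (c - a + (c - a) powr (1 - \<beta>)) * min u (c - a) powr \<tau> * min v (c - a) powr \<beta>"
    by (simp add: L_def mu_def mv_def)
qed

section \<open>The moment function and its second differences\<close>

lemma integrable_forward_moment:
  "integrable lborel (\<lambda>t. indicator {a..c} t * stopped_increment W c (t + w) t)"
proof (rule Bochner_Integration.integrable_bound)
  let ?M = "K * (\<bar>c - a\<bar> + \<bar>w\<bar>) powr \<tau>"
  show "integrable lborel (\<lambda>t. indicator {a..c} t * ?M)"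
    by (intro integrable_mult_left) auto
  show "AE t in lborel. norm (indicator {a..c} t * stopped_increment W c (t + w) t) \<le> norm (indicator {a..c} t * ?M)"
  proof (rule AE_I2)
    fix t
    show "norm (indicator {a..c} t * stopped_increment W c (t + w) t) \<le> norm (indicator {a..c} t * ?M)"
    proof (cases "t \<in> {a..c}")
      case True
      have "\<bar>stopped_increment W c (t + w) t\<bar> \<le> K * \<bar>(t + w) - c\<bar> powr \<tau>"
        using stopped_increment_first[of c "t + w" t c] by (simp add: stopped_increment_beyond)
      also have "\<dots> \<le> ?M"
        using True K_nonneg \<tau>_pos by (intro mult_left_mono powr_mono2) auto
      finally show ?thesis using True K_nonneg by simp
    qed simp
  qed
qed measurable

lemma integral_corner_increment:
  assumes uvw: "0 \<le> u" "0 \<le> v" "0 \<le> w"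
  shows "(\<integral>t. indicator {a..c} t * corner_increment W a c w t v u \<partial>lborel)
    = second_diff (forward_moment W a c) w u v"
proof -
  let ?P = "\<lambda>w t. indicator {a..c} t * stopped_increment W c (t + w) t"
  let ?Z = "\<lambda>w t. indicator {a..c} t * (if t - v < a then 0 else stopped_increment W c (t + w) (t - v))"
  have Z: "?Z w (v + 1 * t) = ?P (w + v) t" if "0 \<le> w" for w t
    using uvw that by (auto simp: indicator_def add_ac intro!: stopped_increment_beyond)
  have intZ: "integrable lborel (?Z w)" if "0 \<le> w" for w
    using integrable_forward_moment[of a c "w + v"] lborel_integrable_real_affine_iff[of 1 "?Z w" v]
    unfolding Z[OF that] by simp
  have eqZ: "(\<integral>t. ?Z w t \<partial>lborel) = forward_moment W a c (w + v)" if "0 \<le> w" for w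
  proof -
    have "(\<integral>t. ?Z w t \<partial>lborel) = (\<integral>t. ?Z w (v + 1 * t) \<partial>lborel)"
      by (subst lborel_integral_real_affine[of 1 _ v]) auto
    then show ?thesis by (simp only: Z[OF that] forward_moment_def)
  qed
  have "(\<integral>t. indicator {a..c} t * corner_increment W a c w t v u \<partial>lborel)
    = (\<integral>t. ?P w t - ?P (w + u) t - (?Z w t - ?Z (w + u) t) \<partial>lborel)"
    by (rule Bochner_Integration.integral_cong)
       (auto simp: corner_increment_def indicator_def add.assoc)
  also have "\<dots> = (\<integral>t. ?P w t \<partial>lborel) - (\<integral>t. ?P (w + u) t \<partial>lborel)
       - ((\<integral>t. ?Z w t \<partial>lborel) - (\<integral>t. ?Z (w + u) t \<partial>lborel))"
    by (rule integral_diff_diff) (intro integrable_forward_moment intZ uvw add_nonneg_nonneg)+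
  also have "\<dots> = second_diff (forward_moment W a c) w u v"
    unfolding eqZ[OF uvw(3)] eqZ[OF add_nonneg_nonneg[OF uvw(3,1)]]
    by (simp add: forward_moment_def second_diff_def add_ac)
  finally show ?thesis .
qed

lemma second_diff_bound_forward_moment:
  assumes "a < c"
  shows "second_diff_bound \<tau> \<beta> (c - a) (K * (c - a + (c - a) powr (1 - \<beta>))) (forward_moment W a c)"
  unfolding second_diff_bound_def
proof (intro allI impI)
  fix w u v :: real assume uvw: "0 \<le> w" "0 < u" "0 < v"
  have "\<bar>second_diff (forward_moment W a c) w u v\<bar>
      \<le> (\<integral>t. \<bar>indicator {a..c} t * corner_increment W a c w t v u\<bar> \<partial>lborel)"
    using uvw by (subst integral_corner_increment[symmetric]) auto
  also have "\<dots> \<le> K * (c - a + (c - a) powr (1 - \<beta>)) * min u (c - a) powr \<tau> * min v (c - a) powr \<beta>"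
    using integral_abs_corner_increment_le[OF assms uvw(2,3,1)] .
  finally show "\<bar>second_diff (forward_moment W a c) w u v\<bar>
      \<le> K * (c - a + (c - a) powr (1 - \<beta>)) * min u (c - a) powr \<tau> * min v (c - a) powr \<beta>" .
qed

lemma forward_moment_beyond: "c - a \<le> w \<Longrightarrow> forward_moment W a c w = 0"
proof -
  assume w: "c - a \<le> w"
  have "indicator {a..c} t * stopped_increment W c (t + w) t = 0" for t
    using w stopped_increment_beyond[of c "t + w" t] by (auto simp: indicator_def)
  then show ?thesis by (simp only: forward_moment_def Bochner_Integration.integral_zero)
qed

lemma continuous_forward_moment: "continuous_on UNIV (forward_moment W a c)"
proof (rule holder_imp_continuous_on[where M = "\<bar>c - a\<bar> * K" and \<sigma> = \<tau>])
  fix x y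
  let ?P = "\<lambda>w t. indicator {a..c} t * stopped_increment W c (t + w) t"
  have "\<bar>forward_moment W a c x - forward_moment W a c y\<bar> = norm (\<integral>t. ?P x t - ?P y t \<partial>lborel)"
    unfolding forward_moment_def
    by (subst Bochner_Integration.integral_diff) (use integrable_forward_moment in auto)
  also have "\<dots> \<le> (\<integral>t. norm (?P x t - ?P y t) \<partial>lborel)"
    by (rule integral_norm_bound)
  also have "\<dots> \<le> (\<integral>t. indicator {a..c} t * (K * \<bar>x - y\<bar> powr \<tau>) \<partial>lborel)"
  proof (rule integral_mono')
    show "norm (?P x t - ?P y t) \<le> indicator {a..c} t * (K * \<bar>x - y\<bar> powr \<tau>)" for t
      using stopped_increment_first[of c "t + x" t "t + y"]
      by (auto simp: indicator_def)
  qed (use K_nonneg in \<open>auto intro!: integrable_mult_left\<close>)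
  also have "\<dots> = measure lborel {a..c} * (K * \<bar>x - y\<bar> powr \<tau>)"
    by simp
  also have "\<dots> \<le> \<bar>c - a\<bar> * (K * \<bar>x - y\<bar> powr \<tau>)"
    using K_nonneg by (intro mult_right_mono) (cases "a \<le> c"; auto)+
  finally show "\<bar>forward_moment W a c x - forward_moment W a c y\<bar> \<le> \<bar>c - a\<bar> * K * \<bar>x - y\<bar> powr \<tau>"
    by (simp add: mult.assoc)
qed (rule \<tau>_pos)

end

subsection \<open>The triple integral\<close>

interpretation lborel_pair_triple: pair_sigma_finite "lborel \<Otimes>\<^sub>M lborel :: (real \<times> real) measure" "lborel :: real measure"
  by (intro pair_sigma_finite.intro lborel_pair.sigma_finite_measure_axioms lborel.sigma_finite_measure_axioms)

context joint_holder
begin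

definition frac_density :: "real \<Rightarrow> real \<Rightarrow> real \<Rightarrow> real \<Rightarrow> real \<Rightarrow> real \<Rightarrow> real" where
  "frac_density \<alpha> a c t v u =
     marchaud_kernel \<alpha> v * marchaud_kernel (1 - \<alpha>) u * corner_increment W a c 0 t v u"

lemma measurable_frac_density [measurable (raw)]:
  assumes [measurable]: "f \<in> borel_measurable M" "g \<in> borel_measurable M" "h \<in> borel_measurable M"
  shows "(\<lambda>x. frac_density \<alpha> a c (f x) (g x) (h x)) \<in> borel_measurable M"
  unfolding frac_density_def by measurable

text \<open>For a single t the cap at t - a absorbs the missing power of v, at the price of a
  constant \<open>M\<close> that blows up as t tends to a. It justifies iterating the u and v
  integrals at fixed t; integrability in t needs the strip estimate instead.\<close>

lemma integrable_frac_density_fixed: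
  assumes t: "a < t" "t \<le> c" and \<alpha>: "0 < \<alpha>" "\<alpha> < \<beta>" "\<alpha> < 1" "1 - \<alpha> < \<tau>"
  shows "integrable (lborel \<Otimes>\<^sub>M lborel) (\<lambda>(v, u). frac_density \<alpha> a c t v u)"
proof (rule Bochner_Integration.integrable_bound)
  define L where "L = t - a"
  define M where "M = max 1 (1 / L powr \<beta>)"
  let ?B = "\<lambda>(v, u). K * M * ((marchaud_kernel \<alpha> v * min v L powr \<beta>)
      * (marchaud_kernel (1 - \<alpha>) u * min u (c - a) powr \<tau>))"
  have pos: "0 < L" "0 < c - a" using t by (auto simp: L_def)
  have M: "1 \<le> M" by (simp add: M_def)
  have "has_bochner_integral (lborel \<Otimes>\<^sub>M lborel)
    (\<lambda>(v, u). (marchaud_kernel \<alpha> v * min v L powr \<beta>) * (marchaud_kernel (1 - \<alpha>) u * min u (c - a) powr \<tau>))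
    (truncated_kernel_mass \<alpha> \<beta> L * truncated_kernel_mass (1 - \<alpha>) \<tau> (c - a))"
    using \<alpha> pos by (intro has_bochner_integral_product_kernel has_bochner_integral_truncated_kernel) auto
  from integrable_mult_right[OF integrable.intros[OF this], of "K * M"]
  show "integrable (lborel \<Otimes>\<^sub>M lborel) ?B"
    by (simp add: case_prod_unfold)
  show "AE z in lborel \<Otimes>\<^sub>M lborel. norm (case z of (v, u) \<Rightarrow> frac_density \<alpha> a c t v u) \<le> norm (?B z)"
  proof (rule AE_I2, clarify)
    fix v u :: real
    show "norm (frac_density \<alpha> a c t v u) \<le> norm (K * M * ((marchaud_kernel \<alpha> v * min v L powr \<beta>)
      * (marchaud_kernel (1 - \<alpha>) u * min u (c - a) powr \<tau>)))"
    proof (cases "0 < u \<and> 0 < v")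
      case True
      have "(if v \<le> t - a then v powr \<beta> else 1) \<le> M * min v L powr \<beta>"
      proof (cases "v \<le> L")
        case True
        then show ?thesis using mult_right_mono[of 1 M "v powr \<beta>"] by (simp add: L_def[symmetric] M_def)
      next
        case False
        have "1 = 1 / L powr \<beta> * L powr \<beta>" using pos by simp
        also have "\<dots> \<le> M * L powr \<beta>" by (intro mult_right_mono) (auto simp: M_def)
        finally show ?thesis using False by (simp add: L_def[symmetric])
      qed
      then have "K * min u (c - a) powr \<tau> * (if v \<le> t - a then v powr \<beta> else 1)
          \<le> K * min u (c - a) powr \<tau> * (M * min v L powr \<beta>)"
        using K_nonneg by (intro mult_left_mono) auto
      then have "\<bar>corner_increment W a c 0 t v u\<bar> \<le> K * min u (c - a) powr \<tau> * (M * min v L powr \<beta>)"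
        using corner_increment_le[of a t c u v 0] t True by simp
      then have "marchaud_kernel \<alpha> v * marchaud_kernel (1 - \<alpha>) u * \<bar>corner_increment W a c 0 t v u\<bar>
         \<le> marchaud_kernel \<alpha> v * marchaud_kernel (1 - \<alpha>) u * (K * min u (c - a) powr \<tau> * (M * min v L powr \<beta>))"
        by (intro mult_left_mono) auto
      also have "\<dots> = K * M * ((marchaud_kernel \<alpha> v * min v L powr \<beta>)
          * (marchaud_kernel (1 - \<alpha>) u * min u (c - a) powr \<tau>))"
        by (simp add: mult_ac)
      finally show ?thesis
        using K_nonneg M by (simp add: frac_density_def abs_mult)
    qed (auto simp: frac_density_def marchaud_kernel_def)
  qed
qed measurable

text \<open>Absolute values are integrated in t first, where the strip estimate leaves a product of
  truncated kernels in v and u.\<close>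

lemma integrable_frac_density:
  assumes ac: "a < c" and \<alpha>: "0 < \<alpha>" "\<alpha> < \<beta>" "\<alpha> < 1" "1 - \<alpha> < \<tau>"
  shows "integrable ((lborel \<Otimes>\<^sub>M lborel) \<Otimes>\<^sub>M lborel)
    (\<lambda>(z, t). indicator {a..c} t * frac_density \<alpha> a c t (fst z) (snd z))"
proof (rule lborel_pair_triple.Fubini_integrable)
  let ?f = "\<lambda>v u t. indicator {a..c} t * frac_density \<alpha> a c t v u"
  let ?g = "\<lambda>v u t. indicator {a..c} t * corner_increment W a c 0 t v u"
  have fg: "?f v u t = marchaud_kernel \<alpha> v * marchaud_kernel (1 - \<alpha>) u * ?g v u t" for v u t
    by (simp add: frac_density_def)
  show meas: "(\<lambda>(z, t). ?f (fst z) (snd z) t) \<in> borel_measurable ((lborel \<Otimes>\<^sub>M lborel) \<Otimes>\<^sub>M lborel)"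
    unfolding case_prod_unfold by measurable
  have fixed: "integrable lborel (\<lambda>t. ?f v u t)" for v u
  proof (cases "0 < u \<and> 0 < v")
    case True
    then show ?thesis
      unfolding fg using integrable_corner_increment[OF ac, of u v 0] by (intro integrable_mult_right) auto
  qed (auto simp: frac_density_def marchaud_kernel_def)
  show "AE z in lborel \<Otimes>\<^sub>M lborel. integrable lborel (\<lambda>t. case (z, t) of (z, t) \<Rightarrow> ?f (fst z) (snd z) t)"
    using fixed by simp
  let ?C = "K * (c - a + (c - a) powr (1 - \<beta>))"
  have C: "0 \<le> ?C" using K_nonneg ac by simp
  let ?B = "\<lambda>(v, u). ?C * ((marchaud_kernel \<alpha> v * min v (c - a) powr \<beta>)
      * (marchaud_kernel (1 - \<alpha>) u * min u (c - a) powr \<tau>))"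
  have "has_bochner_integral (lborel \<Otimes>\<^sub>M lborel)
    (\<lambda>(v, u). (marchaud_kernel \<alpha> v * min v (c - a) powr \<beta>) * (marchaud_kernel (1 - \<alpha>) u * min u (c - a) powr \<tau>))
    (truncated_kernel_mass \<alpha> \<beta> (c - a) * truncated_kernel_mass (1 - \<alpha>) \<tau> (c - a))"
    using \<alpha> ac by (intro has_bochner_integral_majorant) auto
  from integrable_mult_right[OF integrable.intros[OF this], of ?C]
  have B: "integrable (lborel \<Otimes>\<^sub>M lborel) ?B"
    by (simp add: case_prod_unfold)
  show "integrable (lborel \<Otimes>\<^sub>M lborel) (\<lambda>z. \<integral>t. norm (case (z, t) of (z, t) \<Rightarrow> ?f (fst z) (snd z) t) \<partial>lborel)"
  proof (rule Bochner_Integration.integrable_bound[OF B])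
    show "(\<lambda>z. \<integral>t. norm (case (z, t) of (z, t) \<Rightarrow> ?f (fst z) (snd z) t) \<partial>lborel) \<in> borel_measurable (lborel \<Otimes>\<^sub>M lborel)"
      using meas by measurable
    show "AE z in lborel \<Otimes>\<^sub>M lborel. norm (\<integral>t. norm (case (z, t) of (z, t) \<Rightarrow> ?f (fst z) (snd z) t) \<partial>lborel) \<le> norm (?B z)"
    proof (rule AE_I2)
      fix z :: "real \<times> real"
      obtain v u where z: "z = (v, u)" by fastforce
      have "(\<integral>t. \<bar>?f v u t\<bar> \<partial>lborel) \<le> ?C * ((marchaud_kernel \<alpha> v * min v (c - a) powr \<beta>)
          * (marchaud_kernel (1 - \<alpha>) u * min u (c - a) powr \<tau>))"
      proof (cases "0 < u \<and> 0 < v")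
        case True
        have "(\<integral>t. \<bar>?f v u t\<bar> \<partial>lborel) = marchaud_kernel \<alpha> v * marchaud_kernel (1 - \<alpha>) u * (\<integral>t. \<bar>?g v u t\<bar> \<partial>lborel)"
          unfolding fg by (simp add: abs_mult)
        also have "\<dots> \<le> marchaud_kernel \<alpha> v * marchaud_kernel (1 - \<alpha>) u * (?C * min u (c - a) powr \<tau> * min v (c - a) powr \<beta>)"
          using integral_abs_corner_increment_le[OF ac, of u v 0] True by (intro mult_left_mono) auto
        finally show ?thesis by (simp add: mult_ac)
      qed (auto simp: frac_density_def marchaud_kernel_def)
      then show "norm (\<integral>t. norm (case (z, t) of (z, t) \<Rightarrow> ?f (fst z) (snd z) t) \<partial>lborel) \<le> norm (?B z)"
        by (simp add: z order.trans[OF _ abs_ge_self])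
    qed
  qed
qed

lemma
  assumes ac: "a < c" and \<alpha>: "0 < \<alpha>" "\<alpha> < \<beta>" "\<alpha> < 1" "1 - \<alpha> < \<tau>"
  shows integrable_iterated_frac_density:
      "integrable lborel (\<lambda>t. indicator {a..c} t * (\<integral>(v, u). frac_density \<alpha> a c t v u \<partial>(lborel \<Otimes>\<^sub>M lborel)))"
    and integral_iterated_frac_density:
      "(\<integral>t. indicator {a..c} t * (\<integral>(v, u). frac_density \<alpha> a c t v u \<partial>(lborel \<Otimes>\<^sub>M lborel)) \<partial>lborel)
        = kernel_mean \<alpha> (forward_moment W a c)"
proof -
  let ?f = "\<lambda>z t. indicator {a..c} t * frac_density \<alpha> a c t (fst z) (snd z)"
  have I: "integrable ((lborel \<Otimes>\<^sub>M lborel) \<Otimes>\<^sub>M lborel) (\<lambda>(z, t). ?f z t)"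
    by (rule integrable_frac_density[OF assms])
  have eq: "(\<integral>z. ?f z t \<partial>(lborel \<Otimes>\<^sub>M lborel))
      = indicator {a..c} t * (\<integral>(v, u). frac_density \<alpha> a c t v u \<partial>(lborel \<Otimes>\<^sub>M lborel))" for t
    by (simp add: case_prod_unfold)
  show "integrable lborel (\<lambda>t. indicator {a..c} t * (\<integral>(v, u). frac_density \<alpha> a c t v u \<partial>(lborel \<Otimes>\<^sub>M lborel)))"
    using lborel_pair_triple.integrable_snd[OF I] unfolding eq .
  have inner: "(\<integral>t. ?f z t \<partial>lborel) = (case z of (v, u) \<Rightarrow>
      marchaud_kernel \<alpha> v * marchaud_kernel (1 - \<alpha>) u * second_diff (forward_moment W a c) 0 u v)" for z
  proof -
    obtain v u where z: "z = (v, u)" by fastforce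
    have "(\<integral>t. indicator {a..c} t * frac_density \<alpha> a c t v u \<partial>lborel)
      = marchaud_kernel \<alpha> v * marchaud_kernel (1 - \<alpha>) u * (\<integral>t. indicator {a..c} t * corner_increment W a c 0 t v u \<partial>lborel)"
      by (simp add: frac_density_def mult.left_commute[of "indicator {a..c} _"])
    also have "\<dots> = marchaud_kernel \<alpha> v * marchaud_kernel (1 - \<alpha>) u * second_diff (forward_moment W a c) 0 u v"
      by (cases "0 < u \<and> 0 < v") (auto simp: integral_corner_increment marchaud_kernel_def)
    finally show ?thesis by (simp add: z)
  qed
  have "(\<integral>t. indicator {a..c} t * (\<integral>(v, u). frac_density \<alpha> a c t v u \<partial>(lborel \<Otimes>\<^sub>M lborel)) \<partial>lborel)
      = (\<integral>z. \<integral>t. ?f z t \<partial>lborel \<partial>(lborel \<Otimes>\<^sub>M lborel))"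
    using lborel_pair_triple.Fubini_integral[OF I] unfolding eq .
  also have "\<dots> = kernel_mean \<alpha> (forward_moment W a c)"
    unfolding kernel_mean_def by (intro Bochner_Integration.integral_cong refl inner)
  finally show "(\<integral>t. indicator {a..c} t * (\<integral>(v, u). frac_density \<alpha> a c t v u \<partial>(lborel \<Otimes>\<^sub>M lborel)) \<partial>lborel)
        = kernel_mean \<alpha> (forward_moment W a c)" .
qed

end

subsection \<open>Evaluation of the fractional integral\<close>

lemma
  fixes f :: "real \<Rightarrow> real"
  assumes "f absolutely_integrable_on S"
  shows absolutely_integrable_complex_of_real: "(\<lambda>x. complex_of_real (f x)) absolutely_integrable_on S"
    and integral_complex_of_real_HK: "integral S (\<lambda>x. complex_of_real (f x)) = complex_of_real (integral S f)"
proof -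
  show "(\<lambda>x. complex_of_real (f x)) absolutely_integrable_on S"
    using absolutely_integrable_linear[OF assms bounded_linear_of_real[where 'a = complex]] by (simp add: o_def)
  show "integral S (\<lambda>x. complex_of_real (f x)) = complex_of_real (integral S f)"
    using integral_linear[OF _ bounded_linear_of_real[where 'a = complex], of f S] assms
    by (simp add: o_def set_lebesgue_integral_eq_integral(1))
qed

context joint_holder
begin

text \<open>The inner right derivative of order 1 - \<alpha>, stripped of its phase, its Gamma
  factor and the factor 1 - \<alpha>.\<close>

definition right_marchaud :: "real \<Rightarrow> real \<Rightarrow> real \<Rightarrow> real \<Rightarrow> real" where
  "right_marchaud \<alpha> c t t' = (\<integral>u. marchaud_kernel (1 - \<alpha>) u
     * (stopped_increment W c t t' - stopped_increment W c (t + u) t') \<partial>lborel)"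

lemma measurable_right_marchaud [measurable]: "right_marchaud \<alpha> c t \<in> borel_measurable borel"
  unfolding right_marchaud_def[abs_def] by measurable

lemma
  assumes "t < c" and \<alpha>: "\<alpha> < 1" "1 - \<alpha> < \<tau>"
  shows integrable_right_marchaud:
      "integrable lborel (\<lambda>u. marchaud_kernel (1 - \<alpha>) u
         * (stopped_increment W c t t' - stopped_increment W c (t + u) t'))"
    and absolutely_integrable_right_marchaud:
      "(\<lambda>s. (stopped_increment W c t t' - stopped_increment W c s t') / (s - t) powr (1 - \<alpha> + 1))
         absolutely_integrable_on {t..c}"
    and right_marchaud_eq:
      "stopped_increment W c t t' / (c - t) powr (1 - \<alpha>)
         + (1 - \<alpha>) * integral {t..c} (\<lambda>s. (stopped_increment W c t t' - stopped_increment W c s t')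
             / (s - t) powr (1 - \<alpha> + 1))
        = (1 - \<alpha>) * right_marchaud \<alpha> c t t'"
proof -
  have m: "(\<lambda>s. stopped_increment W c s t') \<in> borel_measurable borel"
    by measurable
  have z: "stopped_increment W c s t' = 0" if "c < s" for s
    using that by (intro stopped_increment_beyond) simp
  have h: "\<bar>stopped_increment W c t t' - stopped_increment W c s t'\<bar> \<le> K * \<bar>s - t\<bar> powr \<tau>" for s
    using stopped_increment_first[of c t t' s] by (simp add: abs_minus_commute)
  have \<gamma>: "0 < 1 - \<alpha>" using \<alpha> by simp
  show "integrable lborel (\<lambda>u. marchaud_kernel (1 - \<alpha>) u
         * (stopped_increment W c t t' - stopped_increment W c (t + u) t'))"
    by (rule integrable_marchaud_right[OF m assms(1) z h \<gamma> \<alpha>(2)])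
  show "(\<lambda>s. (stopped_increment W c t t' - stopped_increment W c s t') / (s - t) powr (1 - \<alpha> + 1))
         absolutely_integrable_on {t..c}"
    by (rule absolutely_integrable_marchaud_right[OF m assms(1) z h \<gamma> \<alpha>(2)])
  show "stopped_increment W c t t' / (c - t) powr (1 - \<alpha>)
         + (1 - \<alpha>) * integral {t..c} (\<lambda>s. (stopped_increment W c t t' - stopped_increment W c s t')
             / (s - t) powr (1 - \<alpha> + 1))
        = (1 - \<alpha>) * right_marchaud \<alpha> c t t'"
    unfolding right_marchaud_def
    by (rule marchaud_right_eq[OF m assms(1) z h \<gamma> \<alpha>(2)])
qed

text \<open>The u-integral uses up the order \<tau> of the rectangular bound and leaves order
  \<beta> in the second argument, which is what an outer derivative of order \<alpha> < \<beta>
  needs.\<close>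

lemma right_marchaud_holder:
  assumes t: "a \<le> t" "t < c" and \<alpha>: "\<alpha> < 1" "1 - \<alpha> < \<tau>"
  shows "\<bar>right_marchaud \<alpha> c t t' - right_marchaud \<alpha> c t t''\<bar>
    \<le> K * truncated_kernel_mass (1 - \<alpha>) \<tau> (c - a) * \<bar>t' - t''\<bar> powr \<beta>"
proof -
  let ?P = "stopped_increment W c"
  let ?f = "\<lambda>u. marchaud_kernel (1 - \<alpha>) u * (?P t t' - ?P (t + u) t') - marchaud_kernel (1 - \<alpha>) u * (?P t t'' - ?P (t + u) t'')"
  let ?B = "\<lambda>u. K * \<bar>t' - t''\<bar> powr \<beta> * (marchaud_kernel (1 - \<alpha>) u * min u (c - a) powr \<tau>)"
  have B: "has_bochner_integral lborel ?B (K * \<bar>t' - t''\<bar> powr \<beta> * truncated_kernel_mass (1 - \<alpha>) \<tau> (c - a))"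
    using t \<alpha> by (intro has_bochner_integral_mult_right has_bochner_integral_truncated_kernel) auto
  have "\<bar>?f u\<bar> \<le> ?B u" for u
  proof (cases "0 < u")
    case True
    have "\<bar>?P t t' - ?P (t + u) t' - (?P t t'' - ?P (t + u) t'')\<bar>
        \<le> K * \<bar>min t c - min (t + u) c\<bar> powr \<tau> * \<bar>t' - t''\<bar> powr \<beta>"
      by (rule stopped_increment_rect)
    also have "\<dots> \<le> K * min u (c - a) powr \<tau> * \<bar>t' - t''\<bar> powr \<beta>"
      using K_nonneg \<tau>_pos t True by (intro mult_right_mono mult_left_mono powr_mono2) auto
    finally have "marchaud_kernel (1 - \<alpha>) u * \<bar>?P t t' - ?P (t + u) t' - (?P t t'' - ?P (t + u) t'')\<bar>
        \<le> marchaud_kernel (1 - \<alpha>) u * (K * min u (c - a) powr \<tau> * \<bar>t' - t''\<bar> powr \<beta>)"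
      by (intro mult_left_mono) auto
    moreover have "\<bar>?f u\<bar> = marchaud_kernel (1 - \<alpha>) u * \<bar>?P t t' - ?P (t + u) t' - (?P t t'' - ?P (t + u) t'')\<bar>"
      by (subst right_diff_distrib[symmetric]) (simp add: abs_mult)
    ultimately show ?thesis by (simp add: mult_ac)
  qed (simp add: marchaud_kernel_def)
  then have "norm (\<integral>u. ?f u \<partial>lborel) \<le> integral\<^sup>L lborel ?B"
    using B K_nonneg by (intro order.trans[OF integral_norm_bound] integral_mono') (auto simp: has_bochner_integral_iff)
  also have "integral\<^sup>L lborel ?B = K * \<bar>t' - t''\<bar> powr \<beta> * truncated_kernel_mass (1 - \<alpha>) \<tau> (c - a)"
    by (rule has_bochner_integral_integral_eq[OF B])
  also have "(\<integral>u. ?f u \<partial>lborel) = right_marchaud \<alpha> c t t' - right_marchaud \<alpha> c t t''"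
    unfolding right_marchaud_def
    by (rule Bochner_Integration.integral_diff) (rule integrable_right_marchaud[OF t(2) \<alpha>])+
  finally show ?thesis
    by (simp add: mult_ac)
qed

text \<open>Setting the inner derivative to zero below a matches the conditional in
  \<open>corner_increment\<close>: the difference f t - f (t - v) is the u-integral of the corner
  increment, for t - v on either side of a.\<close>

lemma
  assumes t: "a < t" "t < c" and \<alpha>: "0 < \<alpha>" "\<alpha> < \<beta>" "\<alpha> < 1" "1 - \<alpha> < \<tau>"
  defines "f \<equiv> \<lambda>s. if s < a then 0 else right_marchaud \<alpha> c t s"
  shows absolutely_integrable_left_right_marchaud:
      "(\<lambda>s. (f t - f s) / (t - s) powr (\<alpha> + 1)) absolutely_integrable_on {a..t}"
    and left_right_marchaud_eq:
      "f t / (t - a) powr \<alpha> + \<alpha> * integral {a..t} (\<lambda>s. (f t - f s) / (t - s) powr (\<alpha> + 1))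
        = \<alpha> * (\<integral>(v, u). frac_density \<alpha> a c t v u \<partial>(lborel \<Otimes>\<^sub>M lborel))"
proof -
  have m: "f \<in> borel_measurable borel" unfolding f_def by measurable
  have z: "f s = 0" if "s < a" for s using that by (simp add: f_def)
  have h: "\<bar>f t - f s\<bar> \<le> K * truncated_kernel_mass (1 - \<alpha>) \<tau> (c - a) * \<bar>s - t\<bar> powr \<beta>"
    if "a \<le> s" "s \<le> t" for s
    using right_marchaud_holder[of a t c \<alpha> t s] t \<alpha> that by (simp add: f_def abs_minus_commute)
  show "(\<lambda>s. (f t - f s) / (t - s) powr (\<alpha> + 1)) absolutely_integrable_on {a..t}"
    by (rule absolutely_integrable_marchaud_left[OF m t(1) z h \<alpha>(1,2)])
  have inner: "(\<integral>u. frac_density \<alpha> a c t v u \<partial>lborel) = marchaud_kernel \<alpha> v * (f t - f (t - v))" for v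
  proof -
    let ?P = "stopped_increment W c"
    note I = integrable_right_marchaud[OF t(2) \<alpha>(3,4)]
    have "(\<integral>u. marchaud_kernel (1 - \<alpha>) u * corner_increment W a c 0 t v u \<partial>lborel) = f t - f (t - v)"
    proof (cases "t - v < a")
      case True
      then show ?thesis
        using t by (simp add: f_def corner_increment_def right_marchaud_def)
    next
      case False
      then have "(\<integral>u. marchaud_kernel (1 - \<alpha>) u * corner_increment W a c 0 t v u \<partial>lborel)
          = (\<integral>u. marchaud_kernel (1 - \<alpha>) u * (?P t t - ?P (t + u) t)
              - marchaud_kernel (1 - \<alpha>) u * (?P t (t - v) - ?P (t + u) (t - v)) \<partial>lborel)"
        by (simp add: corner_increment_def right_diff_distrib)
      also have "\<dots> = right_marchaud \<alpha> c t t - right_marchaud \<alpha> c t (t - v)"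
        unfolding right_marchaud_def by (rule Bochner_Integration.integral_diff) (rule I)+
      finally show ?thesis using False t by (simp add: f_def)
    qed
    then show ?thesis by (simp add: frac_density_def mult.assoc)
  qed
  have "(\<integral>z. (case z of (v, u) \<Rightarrow> frac_density \<alpha> a c t v u) \<partial>(lborel \<Otimes>\<^sub>M lborel))
      = (\<integral>v. \<integral>u. frac_density \<alpha> a c t v u \<partial>lborel \<partial>lborel)"
    using lborel_pair.integral_fst'[OF integrable_frac_density_fixed[OF t(1) less_imp_le[OF t(2)] \<alpha>]] by simp
  then show "f t / (t - a) powr \<alpha> + \<alpha> * integral {a..t} (\<lambda>s. (f t - f s) / (t - s) powr (\<alpha> + 1))
        = \<alpha> * (\<integral>(v, u). frac_density \<alpha> a c t v u \<partial>(lborel \<Otimes>\<^sub>M lborel))"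
    unfolding inner by (simp only: marchaud_left_eq[OF m t(1) z h \<alpha>(1,2)])
qed

text \<open>The defining formula sees G only through G s t - G c t on the square, so W may differ
  from G by any function of the second argument alone.\<close>

lemma
  assumes G: "\<And>s t. a \<le> s \<Longrightarrow> s \<le> c \<Longrightarrow> a \<le> t \<Longrightarrow> t \<le> c \<Longrightarrow> G s t - G c t = W s t - W c t"
    and ac: "a < c" and \<alpha>: "0 < \<alpha>" "\<alpha> < \<beta>" "\<alpha> < 1" "1 - \<alpha> < \<tau>"
  shows frac_integral_exists_holder: "frac_integral_exists \<alpha> a c G"
    and frac_integral_eq_kernel_mean:
      "frac_integral \<alpha> a c G = complex_of_real (- (\<alpha> * (1 - \<alpha>) / (Gamma \<alpha> * Gamma (1 - \<alpha>))
         * kernel_mean \<alpha> (forward_moment W a c)))"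
proof -
  let ?P = "stopped_increment W c"
  define \<kappa> :: complex where "\<kappa> = cis (pi * (1 - \<alpha>)) / of_real (Gamma \<alpha>) * of_real (1 - \<alpha>)"
  have P: "G s t' - G c t' = ?P s t'" if "a \<le> s" "s \<le> c" "a \<le> t'" "t' \<le> c" for s t'
    using G[OF that] that by (simp add: stopped_increment_def min_def)
  have right: "frac_deriv_right_exists (1 - \<alpha>) c (\<lambda>s. of_real (G s t' - G c t')) t \<and>
      frac_mixed \<alpha> c G t t' = \<kappa> * of_real (right_marchaud \<alpha> c t t')"
    if t: "a < t" "t < c" "a \<le> t'" "t' \<le> c" for t t'
  proof -
    let ?r = "\<lambda>s. (?P t t' - ?P s t') / (s - t) powr (1 - \<alpha> + 1)"
    let ?g = "\<lambda>s. (complex_of_real (G t t' - G c t') - of_real (G s t' - G c t')) / of_real ((s - t) powr (1 - \<alpha> + 1))"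
    have eq: "?g s = complex_of_real (?r s)" if "s \<in> {t..c}" for s
      using that t by (subst (1 2) P) auto
    note I = absolutely_integrable_right_marchaud[OF t(2) \<alpha>(3,4), of t']
    have "?g absolutely_integrable_on {t..c}"
      by (rule absolutely_integrable_spike[OF absolutely_integrable_complex_of_real[OF I] negligible_empty])
         (use eq in auto)
    then have ex: "frac_deriv_right_exists (1 - \<alpha>) c (\<lambda>s. of_real (G s t' - G c t')) t"
      unfolding frac_deriv_right_exists_def .
    have int: "integral {t..c} ?g = complex_of_real (integral {t..c} ?r)"
      using eq by (subst integral_complex_of_real_HK[OF I, symmetric]) (rule integral_cong)
    have pt: "complex_of_real (G t t' - G c t') = of_real (?P t t')"
      using t by (subst P) auto
    have "frac_mixed \<alpha> c G t t' = cis (pi * (1 - \<alpha>)) / of_real (Gamma \<alpha>) *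
        of_real (?P t t' / (c - t) powr (1 - \<alpha>) + (1 - \<alpha>) * integral {t..c} ?r)"
      unfolding frac_mixed_def frac_deriv_right_def int unfolding pt by simp
    with ex show ?thesis
      unfolding right_marchaud_eq[OF t(2) \<alpha>(3,4)] by (simp add: \<kappa>_def)
  qed
  have left: "frac_deriv_left_exists \<alpha> a (frac_mixed \<alpha> c G t) t \<and>
      frac_integrand \<alpha> a c G t = \<kappa> * of_real (\<alpha> / Gamma (1 - \<alpha>))
         * of_real (\<integral>(v, u). frac_density \<alpha> a c t v u \<partial>(lborel \<Otimes>\<^sub>M lborel))"
    if t: "a < t" "t < c" for t
  proof -
    let ?f = "\<lambda>s. if s < a then 0 else right_marchaud \<alpha> c t s"
    let ?r = "\<lambda>s. (?f t - ?f s) / (t - s) powr (\<alpha> + 1)"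
    let ?g = "\<lambda>s. (frac_mixed \<alpha> c G t t - frac_mixed \<alpha> c G t s) / of_real ((t - s) powr (\<alpha> + 1))"
    have mixed: "frac_mixed \<alpha> c G t s = \<kappa> * of_real (?f s)" if "a \<le> s" "s \<le> t" for s
      using right[OF t, of s] that t by simp
    have eq: "?g s = \<kappa> * complex_of_real (?r s)" if "s \<in> {a..t}" for s
      using that t mixed[of t] mixed[of s] by (simp add: right_diff_distrib)
    note I = absolutely_integrable_left_right_marchaud[OF t \<alpha>]
    have I': "(\<lambda>s. \<kappa> * complex_of_real (?r s)) absolutely_integrable_on {a..t}"
      by (rule set_integrable_mult_right) (rule absolutely_integrable_complex_of_real[OF I])
    have "?g absolutely_integrable_on {a..t}"
      by (rule absolutely_integrable_spike[OF I' negligible_empty]) (use eq in auto)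
    then have ex: "frac_deriv_left_exists \<alpha> a (frac_mixed \<alpha> c G t) t"
      unfolding frac_deriv_left_exists_def .
    have int: "integral {a..t} ?g = \<kappa> * complex_of_real (integral {a..t} ?r)"
    proof -
      have "integral {a..t} ?g = integral {a..t} (\<lambda>s. \<kappa> * complex_of_real (?r s))"
        using eq by (rule integral_cong)
      also have "\<dots> = \<kappa> * integral {a..t} (\<lambda>s. complex_of_real (?r s))"
        by (rule integral_mult_right)
      finally show ?thesis by (simp only: integral_complex_of_real_HK[OF I])
    qed
    have mt: "frac_mixed \<alpha> c G t t = \<kappa> * of_real (?f t)"
      using mixed[of t] t by simp
    have "frac_integrand \<alpha> a c G t = \<kappa> * of_real (1 / Gamma (1 - \<alpha>)) *
        of_real (?f t / (t - a) powr \<alpha> + \<alpha> * integral {a..t} ?r)"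
      unfolding frac_integrand_def frac_deriv_left_def int unfolding mt
      by (simp only: of_real_add of_real_mult of_real_divide of_real_inverse of_real_1 divide_inverse mult_1_left
          distrib_left mult_ac)
    with ex show ?thesis
      unfolding left_right_marchaud_eq[OF t \<alpha>] by simp
  qed
  let ?k = "\<lambda>t. \<integral>(v, u). frac_density \<alpha> a c t v u \<partial>(lborel \<Otimes>\<^sub>M lborel)"
  have S: "set_integrable lborel {a..c} ?k"
    using integrable_iterated_frac_density[OF ac \<alpha>] by (simp add: set_integrable_def)
  have k_int: "integral {a..c} ?k = kernel_mean \<alpha> (forward_moment W a c)"
    using set_borel_integral_eq_integral(2)[OF S] integral_iterated_frac_density[OF ac \<alpha>]
    by (simp add: set_lebesgue_integral_def)
  have k: "?k absolutely_integrable_on {a..c}"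
    using S integrable_completion[of "\<lambda>t. indicator {a..c} t *\<^sub>R ?k t" lborel]
    unfolding set_integrable_def by (auto dest: borel_measurable_integrable)
  let ?C = "\<kappa> * of_real (\<alpha> / Gamma (1 - \<alpha>))"
  have k': "(\<lambda>t. ?C * complex_of_real (?k t)) absolutely_integrable_on {a..c}"
    by (rule set_integrable_mult_right) (rule absolutely_integrable_complex_of_real[OF k])
  \<comment> \<open>The pointwise formula holds in the open interval; the two endpoints form a null
    set, so the values there do not matter.\<close>
  have ae: "frac_integrand \<alpha> a c G t = ?C * complex_of_real (?k t)" if "t \<in> {a..c} - {a, c}" for t
    using that left[of t] by auto
  have "frac_integrand \<alpha> a c G absolutely_integrable_on {a..c}"
    by (rule absolutely_integrable_spike[where S = "{a, c}", OF k']) (use ae in auto)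
  then show "frac_integral_exists \<alpha> a c G"
    unfolding frac_integral_exists_def using right left by auto
  have "integral {a..c} (frac_integrand \<alpha> a c G) = integral {a..c} (\<lambda>t. ?C * complex_of_real (?k t))"
    by (rule integral_spike[of "{a, c}"]) (use ae in auto)
  also have "\<dots> = ?C * integral {a..c} (\<lambda>t. complex_of_real (?k t))"
    by (rule integral_mult_right)
  also have "\<dots> = ?C * of_real (kernel_mean \<alpha> (forward_moment W a c))"
    by (simp only: integral_complex_of_real_HK[OF k] k_int)
  finally have "frac_integral \<alpha> a c G = (cis (pi * \<alpha>) * cis (pi * (1 - \<alpha>))) *
      of_real (\<alpha> * (1 - \<alpha>) / (Gamma \<alpha> * Gamma (1 - \<alpha>)) * kernel_mean \<alpha> (forward_moment W a c))"
    by (simp add: frac_integral_def \<kappa>_def)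
  \<comment> \<open>The outer phase and that of the inner derivative have total angle pi. This makes
    the value real and produces its minus sign.\<close>
  also have "cis (pi * \<alpha>) * cis (pi * (1 - \<alpha>)) = - 1"
    by (simp add: cis_mult algebra_simps)
  finally show "frac_integral \<alpha> a c G = complex_of_real (- (\<alpha> * (1 - \<alpha>) / (Gamma \<alpha> * Gamma (1 - \<alpha>))
         * kernel_mean \<alpha> (forward_moment W a c)))"
    by simp
qed

end

subsection \<open>The forward integral\<close>

context joint_holder
begin

definition forward_quotient :: "real \<Rightarrow> real \<Rightarrow> real \<Rightarrow> real" where
  "forward_quotient a c w = (forward_moment W a c w - forward_moment W a c 0) / w"

text \<open>A fixed sequence of step sizes suffices, as the definition only has to single out a
  number that does not mention \<alpha>.\<close>

definition forward_integral :: "real \<Rightarrow> real \<Rightarrow> real" where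
  "forward_integral a c = lim (\<lambda>n. forward_quotient a c (inverse (real (Suc n))))"

text \<open>The left-hand side is free of \<alpha>, so all admissible orders give the same
  number.\<close>

lemma
  assumes ac: "a < c" and \<alpha>: "0 < \<alpha>" "\<alpha> < \<beta>" "\<alpha> < 1" "1 - \<alpha> < \<tau>"
  shows forward_quotient_tendsto:
      "(\<lambda>n. forward_quotient a c (inverse (real (Suc n)))) \<longlonglongrightarrow> forward_integral a c"
    and forward_integral_eq_kernel_mean:
      "forward_integral a c = - (\<alpha> * (1 - \<alpha>) / (Gamma \<alpha> * Gamma (1 - \<alpha>)) * kernel_mean \<alpha> (forward_moment W a c))"
proof -
  let ?A = "forward_moment W a c"
  let ?v = "- (\<alpha> * (1 - \<alpha>) / (Gamma \<alpha> * Gamma (1 - \<alpha>)) * kernel_mean \<alpha> ?A)"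
  let ?q = "\<lambda>n. forward_quotient a c (inverse (real (Suc n)))"
  have g: "Gamma \<alpha> > 0" "Gamma (1 - \<alpha>) > 0" using \<alpha> by auto
  have beta: "Beta \<alpha> (1 - \<alpha>) = Gamma \<alpha> * Gamma (1 - \<alpha>)" by (simp add: Beta_def)
  \<comment> \<open>Since Gamma 1 = 1, \<open>Beta \<alpha> (1 - \<alpha>)\<close> is the product of
    the two Gamma values, and the normalisation of the derivatives inverts the constant of the
    kernel integral.\<close>
  have cancel: "- (\<alpha> * (1 - \<alpha>) / (Gamma \<alpha> * Gamma (1 - \<alpha>)) * (Beta \<alpha> (1 - \<alpha>) / (\<alpha> * (1 - \<alpha>)) * (- x))) = x" for x
  proof -
    have "Gamma \<alpha> \<noteq> 0" "Gamma (1 - \<alpha>) \<noteq> 0" using g by linarith+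
    then show ?thesis using \<alpha> by (simp add: beta)
  qed
  have C: "0 \<le> K * (c - a + (c - a) powr (1 - \<beta>))" using K_nonneg ac by simp
  have "(\<lambda>n. Beta \<alpha> (1 - \<alpha>) / (\<alpha> * (1 - \<alpha>)) *
      (- ((?A (inverse (real (Suc n))) - ?A 0) / inverse (real (Suc n))))) \<longlonglongrightarrow> kernel_mean \<alpha> ?A"
    by (rule kernel_mean_eq_difference_quotient_limit[OF second_diff_bound_forward_moment[OF ac] C \<alpha>])
       (use ac in \<open>auto intro: continuous_forward_moment forward_moment_beyond LIMSEQ_inverse_real_of_nat simp del: of_nat_Suc\<close>)
  from tendsto_mult_left[OF this, of "- (\<alpha> * (1 - \<alpha>) / (Gamma \<alpha> * Gamma (1 - \<alpha>)))"]
  have "?q \<longlonglongrightarrow> ?v"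
    unfolding mult_minus_left cancel forward_quotient_def .
  then show "?q \<longlonglongrightarrow> forward_integral a c" "forward_integral a c = ?v"
    by (auto simp: forward_integral_def limI)
qed

text \<open>With L = c - a the kernel masses contribute \<open>L powr (\<beta> - \<alpha>)\<close>
  and \<open>L powr (\<tau> - (1 - \<alpha>))\<close>, so \<alpha> cancels from the exponent. The
  factor L + \<open>L powr (1 - \<beta>)\<close> completes the product to
  (\<open>L powr \<beta>\<close> + 1) * \<open>L powr \<tau>\<close>.\<close>

lemma forward_integral_le:
  assumes \<alpha>: "0 < \<alpha>" "\<alpha> < \<beta>" "\<alpha> < 1" "1 - \<alpha> < \<tau>"
  shows "\<exists>M\<ge>0. \<forall>a c. a < c \<longrightarrow> c - a \<le> L0 \<longrightarrow> \<bar>forward_integral a c\<bar> \<le> M * (c - a) powr \<tau>"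
proof -
  define k where "k = \<alpha> * (1 - \<alpha>) / (Gamma \<alpha> * Gamma (1 - \<alpha>))"
  define m where "m = (1 / (\<beta> - \<alpha>) + 1 / \<alpha>) * (1 / (\<tau> - (1 - \<alpha>)) + 1 / (1 - \<alpha>))"
  have k: "0 \<le> k" using \<alpha> by (simp add: k_def)
  have m: "0 \<le> m" using \<alpha> by (simp add: m_def)
  have "\<bar>forward_integral a c\<bar> \<le> k * K * m * (L0 powr \<beta> + 1) * (c - a) powr \<tau>"
    if ac: "a < c" "c - a \<le> L0" for a c
  proof -
    define L where "L = c - a"
    have L: "0 < L" "L \<le> L0" using ac by (auto simp: L_def)
    have C: "0 \<le> K * (L + L powr (1 - \<beta>))" using K_nonneg L by simp
    have "\<bar>forward_integral a c\<bar> = k * \<bar>kernel_mean \<alpha> (forward_moment W a c)\<bar>"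
      using k by (simp add: forward_integral_eq_kernel_mean[OF ac(1) \<alpha>] k_def[symmetric] abs_mult)
    also have "\<dots> \<le> k * (K * (L + L powr (1 - \<beta>)) * (truncated_kernel_mass \<alpha> \<beta> L * truncated_kernel_mass (1 - \<alpha>) \<tau> L))"
      using second_diff_bound_forward_moment[OF ac(1)] k C L(1)
      by (intro mult_left_mono kernel_mean_le \<alpha>) (auto simp: L_def)
    also have "\<dots> = k * K * m * ((L + L powr (1 - \<beta>)) * (L powr (\<beta> - \<alpha>) * L powr (\<tau> - (1 - \<alpha>))))"
      by (simp add: truncated_kernel_mass_def m_def)
    also have "(L + L powr (1 - \<beta>)) * (L powr (\<beta> - \<alpha>) * L powr (\<tau> - (1 - \<alpha>))) = (L powr \<beta> + 1) * L powr \<tau>"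
    proof -
      have "L powr (\<beta> - \<alpha>) * L powr (\<tau> - (1 - \<alpha>)) = L powr (\<beta> + \<tau> - 1)"
        by (simp add: powr_add[symmetric] algebra_simps)
      moreover have "L * L powr (\<beta> + \<tau> - 1) = L powr \<beta> * L powr \<tau>"
        using L powr_add[of L 1 "\<beta> + \<tau> - 1"] by (simp add: powr_add)
      moreover have "L powr (1 - \<beta>) * L powr (\<beta> + \<tau> - 1) = L powr \<tau>"
        by (simp add: powr_add[symmetric])
      ultimately show ?thesis by (simp add: distrib_right)
    qed
    also have "k * K * m * ((L powr \<beta> + 1) * L powr \<tau>) \<le> k * K * m * ((L0 powr \<beta> + 1) * L powr \<tau>)"
      using k m K_nonneg L \<beta>_pos
      by (intro mult_left_mono mult_right_mono add_right_mono powr_mono2) auto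
    finally show ?thesis by (simp add: L_def mult.assoc)
  qed
  moreover have "0 \<le> k * K * m * (L0 powr \<beta> + 1)"
    using k m K_nonneg by (intro mult_nonneg_nonneg add_nonneg_nonneg) auto
  ultimately show ?thesis by blast
qed

text \<open>The integrands differ only for t within w of the junction c, where the first piece is
  frozen at c while the whole continues. A strip of length w times an increment of size K *
  \<open>w powr \<tau>\<close> remains negligible after division by w.\<close>

lemma forward_moment_split:
  assumes acd: "a < c" "c < d" and w: "0 < w"
  shows "\<bar>(forward_moment W a d w - forward_moment W a d 0)
      - (forward_moment W a c w - forward_moment W a c 0)
      - (forward_moment W c d w - forward_moment W c d 0)\<bar> \<le> K * w powr \<tau> * w"
proof -
  let ?p = "\<lambda>c t. W (min (t + w) c) t - W (min t c) t"
  have diff: "integrable lborel (\<lambda>t. indicator {x..y} t * ?p y t) \<and>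
      forward_moment W x y w - forward_moment W x y 0 = (\<integral>t. indicator {x..y} t * ?p y t \<partial>lborel)" for x y
  proof -
    note I = integrable_forward_moment[of x y w] integrable_forward_moment[of x y 0]
    have e: "indicator {x..y} t * stopped_increment W y (t + w) t - indicator {x..y} t * stopped_increment W y (t + 0) t
      = indicator {x..y} t * ?p y t" for t
      by (simp add: stopped_increment_def right_diff_distrib)
    show ?thesis
      using Bochner_Integration.integrable_diff[OF I] Bochner_Integration.integral_diff[OF I]
      unfolding e by (simp add: forward_moment_def)
  qed
  note I = diff[of a d, THEN conjunct1] diff[of a c, THEN conjunct1] diff[of c d, THEN conjunct1]
  let ?g = "\<lambda>t. indicator {a..d} t * ?p d t - indicator {a..c} t * ?p c t - indicator {c..d} t * ?p d t"
  let ?B = "\<lambda>t. indicator {c - w..c} t * (K * w powr \<tau>)"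
  have "\<bar>?g t\<bar> \<le> ?B t" for t
  proof (cases "a \<le> t \<and> t < c")
    case True
    then have g: "?g t = W (min (t + w) d) t - W (min (t + w) c) t"
      using acd by (simp add: min_def)
    show ?thesis
    proof (cases "t + w \<le> c")
      case True
      then show ?thesis unfolding g using acd K_nonneg by (simp add: min_def)
    next
      case False
      have "\<bar>?g t\<bar> \<le> K * \<bar>min (t + w) d - min (t + w) c\<bar> powr \<tau>"
        unfolding g by (rule W_first)
      also have "\<dots> \<le> K * w powr \<tau>"
        using False True acd K_nonneg \<tau>_pos by (intro mult_left_mono powr_mono2) auto
      finally show ?thesis using False True by simp
    qed
  next
    case False
    \<comment> \<open>At t = c the indicators of both pieces are 1, but the increment frozen at c
      vanishes there.\<close>
    then have "?g t = 0"
      using acd w by (cases "t = c") (auto simp: indicator_def)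
    then show ?thesis using K_nonneg by simp
  qed
  then have "norm (\<integral>t. ?g t \<partial>lborel) \<le> integral\<^sup>L lborel ?B"
    using K_nonneg by (intro order.trans[OF integral_norm_bound] integral_mono') auto
  also have "integral\<^sup>L lborel ?B = K * w powr \<tau> * w"
    using w by simp
  also have "(\<integral>t. ?g t \<partial>lborel) = (\<integral>t. indicator {a..d} t * ?p d t \<partial>lborel)
     - (\<integral>t. indicator {a..c} t * ?p c t \<partial>lborel) - (\<integral>t. indicator {c..d} t * ?p d t \<partial>lborel)"
    using Bochner_Integration.integral_diff[OF Bochner_Integration.integrable_diff[OF I(1,2)] I(3)]
      Bochner_Integration.integral_diff[OF I(1,2)] by simp
  finally show ?thesis
    unfolding diff[THEN conjunct2] real_norm_def .
qed

lemma forward_integral_additive: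
  assumes acd: "a < c" "c < d" and \<alpha>: "0 < \<alpha>" "\<alpha> < \<beta>" "\<alpha> < 1" "1 - \<alpha> < \<tau>"
  shows "forward_integral a d = forward_integral a c + forward_integral c d"
proof -
  let ?d = "\<lambda>n. inverse (real (Suc n))"
  let ?e = "\<lambda>n. forward_quotient a d (?d n) - forward_quotient a c (?d n) - forward_quotient c d (?d n)"
  have "?e \<longlonglongrightarrow> 0"
  proof (rule Lim_null_comparison[where g = "\<lambda>n. K * ?d n powr \<tau>"])
    show "\<forall>\<^sub>F n in sequentially. norm (?e n) \<le> K * ?d n powr \<tau>"
    proof (rule always_eventually, rule allI)
      fix n
      have d: "0 < ?d n" by simp
      then show "norm (?e n) \<le> K * ?d n powr \<tau>"
        using forward_moment_split[OF acd d]
        by (simp add: forward_quotient_def diff_divide_distrib[symmetric] abs_divide pos_divide_le_eq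
             del: of_nat_Suc inverse_eq_divide)
    qed
    have "(\<lambda>n. ?d n powr \<tau>) \<longlonglongrightarrow> 0 powr \<tau>"
      by (rule tendsto_powr'[OF LIMSEQ_inverse_real_of_nat tendsto_const]) (use \<tau>_pos in auto)
    from tendsto_mult_left[OF this, of K] show "(\<lambda>n. K * ?d n powr \<tau>) \<longlonglongrightarrow> 0"
      by simp
  qed
  moreover have "?e \<longlonglongrightarrow> forward_integral a d - forward_integral a c - forward_integral c d"
    using acd \<alpha> by (intro tendsto_diff forward_quotient_tendsto) auto
  ultimately have "forward_integral a d - forward_integral a c - forward_integral c d = 0"
    by (rule LIMSEQ_unique[symmetric])
  then show ?thesis by simp
qed

end

subsection \<open>Iteration\<close>

text \<open>Nonemptiness of the window, part of the predicate for c \<noteq> a, supplies an order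
  whose formula pins down the value.\<close>

lemma has_nl_integral_unique:
  assumes "has_nl_integral \<tau> lam a c h F v" "has_nl_integral \<tau> lam a c h F v'"
  shows "v = v'"
proof (cases "c = a")
  case False
  then obtain \<alpha> where "\<alpha> \<in> {1 - \<tau><..<min lam \<tau>}"
    using assms(1) unfolding has_nl_integral_def by (metis equals0I)
  then have "complex_of_real v = complex_of_real v'"
    using assms False unfolding has_nl_integral_def by metis
  then show ?thesis by simp
qed (use assms in \<open>auto simp: has_nl_integral_def\<close>)

lemma nl_integral_eqI: "has_nl_integral \<tau> lam a c h F v \<Longrightarrow> nl_integral \<tau> lam a c h F = v"
  unfolding nl_integral_def by (blast intro: has_nl_integral_unique)

section \<open>Reduction to global Hoelder bounds\<close>

lemma holder_onE:
  assumes "holder_on \<gamma> S f"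
  obtains C where "0 \<le> C" "\<And>s t. s \<in> S \<Longrightarrow> t \<in> S \<Longrightarrow> \<bar>f s - f t\<bar> \<le> C * \<bar>s - t\<bar> powr \<gamma>"
proof -
  obtain C where C: "\<And>s t. s \<in> S \<Longrightarrow> t \<in> S \<Longrightarrow> \<bar>f s - f t\<bar> \<le> C * \<bar>s - t\<bar> powr \<gamma>"
    using assms unfolding holder_on_def by blast
  show ?thesis
  proof
    show "\<bar>f s - f t\<bar> \<le> max 0 C * \<bar>s - t\<bar> powr \<gamma>" if "s \<in> S" "t \<in> S" for s t
      using C[OF that] mult_right_mono[of C "max 0 C" "\<bar>s - t\<bar> powr \<gamma>"] by simp
  qed simp
qed

lemma powr_le_scaled:
  assumes "0 \<le> x" "x \<le> (D::real)" "\<beta> \<le> \<gamma>"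
  shows "x powr \<gamma> \<le> D powr (\<gamma> - \<beta>) * x powr \<beta>"
proof -
  have "x powr \<gamma> = x powr (\<gamma> - \<beta>) * x powr \<beta>"
    by (simp add: powr_add[symmetric])
  also have "\<dots> \<le> D powr (\<gamma> - \<beta>) * x powr \<beta>"
    using assms by (intro mult_right_mono powr_mono2) auto
  finally show ?thesis .
qed

lemma holder_on_weaken:
  assumes "holder_on \<gamma> {a..b} f" "\<beta> \<le> \<gamma>"
  shows "holder_on \<beta> {a..b} f"
proof -
  obtain C where C: "0 \<le> C" "\<And>s t. s \<in> {a..b} \<Longrightarrow> t \<in> {a..b} \<Longrightarrow> \<bar>f s - f t\<bar> \<le> C * \<bar>s - t\<bar> powr \<gamma>"
    using holder_onE[OF assms(1)] by metis
  have "\<bar>f s - f t\<bar> \<le> C * (b - a) powr (\<gamma> - \<beta>) * \<bar>s - t\<bar> powr \<beta>" if "s \<in> {a..b}" "t \<in> {a..b}" for s t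
  proof -
    have "\<bar>s - t\<bar> powr \<gamma> \<le> (b - a) powr (\<gamma> - \<beta>) * \<bar>s - t\<bar> powr \<beta>"
      using that assms(2) by (intro powr_le_scaled) auto
    from mult_left_mono[OF this C(1)] show ?thesis
      using C(2)[OF that] by (simp add: mult.assoc)
  qed
  then show ?thesis unfolding holder_on_def by blast
qed

text \<open>W is jointly continuous: as it vanishes at first argument a, the rectangular bound
  against that line controls W itself in its second argument.\<close>

lemma rect_holder_borel_measurable:
  fixes W :: "real \<Rightarrow> real \<Rightarrow> real"
  assumes first: "\<And>s s' t. \<bar>W s t - W s' t\<bar> \<le> K * \<bar>s - s'\<bar> powr \<tau>"
    and rect: "\<And>s s' t t'. \<bar>W s t - W s' t - W s t' + W s' t'\<bar> \<le> K * \<bar>s - s'\<bar> powr \<tau> * \<bar>t - t'\<bar> powr \<beta>"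
    and zero: "\<And>t. W a t = 0" and pos: "0 < \<tau>" "0 < \<beta>"
  shows "(\<lambda>(s, t). W s t) \<in> borel_measurable (borel \<Otimes>\<^sub>M borel)"
proof -
  have "isCont (\<lambda>z. W (fst z) (snd z)) x" for x
  proof -
    let ?g = "\<lambda>z. K * \<bar>fst z - fst x\<bar> powr \<tau> + K * \<bar>a - fst x\<bar> powr \<tau> * \<bar>snd z - snd x\<bar> powr \<beta>"
    have le: "norm (W (fst z) (snd z) - W (fst x) (snd x)) \<le> ?g z" for z
      using first[of "fst z" "snd z" "fst x"] rect[of a "snd z" "fst x" "snd x"] by (simp add: zero)
    have "((\<lambda>z. \<bar>fst z - fst x\<bar>) \<longlongrightarrow> \<bar>fst x - fst x\<bar>) (at x)" "((\<lambda>z. \<bar>snd z - snd x\<bar>) \<longlongrightarrow> \<bar>snd x - snd x\<bar>) (at x)"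
      by (intro tendsto_intros)+
    from this[THEN tendsto_powr'[OF _ tendsto_const]] have "((\<lambda>z. \<bar>fst z - fst x\<bar> powr \<tau>) \<longlongrightarrow> \<bar>fst x - fst x\<bar> powr \<tau>) (at x)"
        "((\<lambda>z. \<bar>snd z - snd x\<bar> powr \<beta>) \<longlongrightarrow> \<bar>snd x - snd x\<bar> powr \<beta>) (at x)"
      using pos by simp_all
    then have "(?g \<longlongrightarrow> K * \<bar>fst x - fst x\<bar> powr \<tau> + K * \<bar>a - fst x\<bar> powr \<tau> * \<bar>snd x - snd x\<bar> powr \<beta>) (at x)"
      by (intro tendsto_add tendsto_mult tendsto_const)
    then have "(?g \<longlongrightarrow> 0) (at x)" by simp
    then have "((\<lambda>z. W (fst z) (snd z) - W (fst x) (snd x)) \<longlongrightarrow> 0) (at x)"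
      by (rule Lim_null_comparison[OF always_eventually, rotated]) (use le in blast)
    then show ?thesis
      unfolding isCont_def by (rule iffD2[OF Lim_null])
  qed
  then have "continuous_on UNIV (\<lambda>z. W (fst z) (snd z))"
    by (simp add: continuous_on_eq_continuous_at)
  then have "(\<lambda>z. W (fst z) (snd z)) \<in> borel_measurable borel"
    by (rule borel_measurable_continuous_onI)
  then show ?thesis by (simp add: borel_prod case_prod_unfold)
qed

text \<open>Clamping the arguments to \<open>[a, b]\<close> and subtracting \<open>F a t\<close>, which changes no increment in the
  first argument, turns \<open>h t * F s t\<close> into a function satisfying global Hoelder bounds.\<close>

lemma joint_holder_clamped:
  fixes h :: "real \<Rightarrow> real" and F :: "real \<Rightarrow> real \<Rightarrow> real"
  assumes ab: "a < b" and \<tau>: "0 < \<tau>" and \<beta>: "0 < \<beta>" "\<beta> \<le> 1" "\<beta> \<le> lam"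
    and rect: "rect_holder_on \<tau> lam {a..b} F" and first: "holder_on \<tau> {a..b} (\<lambda>s. F s a)"
    and h: "holder_on \<beta> {a..b} h"
  obtains W K where "joint_holder W \<tau> \<beta> K"
    "\<And>s t. s \<in> {a..b} \<Longrightarrow> t \<in> {a..b} \<Longrightarrow> W s t = h t * (F s t - F a t)"
proof -
  define p where "p = (\<lambda>r. max a (min r b))"
  have p: "p r \<in> {a..b}" "a \<le> p r" "p r \<le> b" for r using ab by (auto simp: p_def)
  have p_id: "p r = r" if "r \<in> {a..b}" for r using that by (auto simp: p_def)
  have p_lip: "\<bar>p r - p r'\<bar> powr \<gamma> \<le> \<bar>r - r'\<bar> powr \<gamma>" if "0 < \<gamma>" for r r' \<gamma>
    using that by (intro powr_mono2) (auto simp: p_def)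
  obtain C0 where C0: "\<And>s1 s2 t1 t2. s1 \<in> {a..b} \<Longrightarrow> s2 \<in> {a..b} \<Longrightarrow> t1 \<in> {a..b} \<Longrightarrow> t2 \<in> {a..b} \<Longrightarrow>
      \<bar>F s1 t1 - F s2 t1 - F s1 t2 + F s2 t2\<bar> \<le> C0 * \<bar>s1 - s2\<bar> powr \<tau> * \<bar>t1 - t2\<bar> powr lam"
    using rect unfolding rect_holder_on_def by metis
  define C where "C = max 0 C0"
  have C: "0 \<le> C" by (simp add: C_def)
  have C1: "\<bar>F s1 t1 - F s2 t1 - F s1 t2 + F s2 t2\<bar> \<le> C * (\<bar>s1 - s2\<bar> powr \<tau> * \<bar>t1 - t2\<bar> powr lam)"
    if "s1 \<in> {a..b}" "s2 \<in> {a..b}" "t1 \<in> {a..b}" "t2 \<in> {a..b}" for s1 s2 t1 t2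
    using C0[OF that] mult_right_mono[of C0 C "\<bar>s1 - s2\<bar> powr \<tau> * \<bar>t1 - t2\<bar> powr lam"]
    by (simp add: C_def mult.assoc)
  obtain A where A: "0 \<le> A" "\<And>s t. s \<in> {a..b} \<Longrightarrow> t \<in> {a..b} \<Longrightarrow> \<bar>F s a - F t a\<bar> \<le> A * \<bar>s - t\<bar> powr \<tau>"
    using holder_onE[OF first] by metis
  obtain H where H: "0 \<le> H" "\<And>s t. s \<in> {a..b} \<Longrightarrow> t \<in> {a..b} \<Longrightarrow> \<bar>h s - h t\<bar> \<le> H * \<bar>s - t\<bar> powr \<beta>"
    using holder_onE[OF h] by metis
  define S where "S = \<bar>h a\<bar> + H * (b - a) powr \<beta>"
  \<comment> \<open>The slice t = a has a Hoelder constant of its own; the rectangular bound over a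
    distance of at most b - a carries it to every other slice.\<close>
  define D where "D = A + C * (b - a) powr lam"
  define C' where "C' = C * (b - a) powr (lam - \<beta>)"
  have nonneg: "0 \<le> S" "0 \<le> D" "0 \<le> C'"
    using H A C by (auto simp: S_def D_def C'_def)
  have S: "\<bar>h (p t)\<bar> \<le> S" for t
  proof -
    have "\<bar>h (p t) - h a\<bar> \<le> H * \<bar>p t - a\<bar> powr \<beta>" using p ab by (intro H) auto
    also have "\<dots> \<le> H * (b - a) powr \<beta>"
      using H p \<beta> by (intro mult_left_mono powr_mono2) auto
    finally show ?thesis by (simp add: S_def)
  qed
  have D: "\<bar>F (p s) (p t) - F (p s') (p t)\<bar> \<le> D * \<bar>s - s'\<bar> powr \<tau>" for s s' t
  proof -
    have "\<bar>F (p s) (p t) - F (p s') (p t)\<bar>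
        \<le> \<bar>F (p s) a - F (p s') a\<bar> + \<bar>F (p s) (p t) - F (p s') (p t) - F (p s) a + F (p s') a\<bar>"
      by linarith
    also have "\<dots> \<le> A * \<bar>p s - p s'\<bar> powr \<tau> + C * (\<bar>p s - p s'\<bar> powr \<tau> * \<bar>p t - a\<bar> powr lam)"
      using p ab by (intro add_mono A C1) auto
    also have "\<dots> \<le> A * \<bar>p s - p s'\<bar> powr \<tau> + C * (\<bar>p s - p s'\<bar> powr \<tau> * (b - a) powr lam)"
      using p[of t] \<beta> C by (intro add_left_mono mult_left_mono powr_mono2) auto
    also have "\<dots> = D * \<bar>p s - p s'\<bar> powr \<tau>"
      by (simp add: D_def algebra_simps)
    also have "\<dots> \<le> D * \<bar>s - s'\<bar> powr \<tau>"
      using nonneg \<tau> by (intro mult_left_mono p_lip)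
    finally show ?thesis .
  qed
  have R: "\<bar>F (p s) (p t) - F (p s') (p t) - F (p s) (p t') + F (p s') (p t')\<bar>
      \<le> C' * (\<bar>s - s'\<bar> powr \<tau> * \<bar>t - t'\<bar> powr \<beta>)" for s s' t t'
  proof -
    have "\<bar>p t - p t'\<bar> powr lam \<le> (b - a) powr (lam - \<beta>) * \<bar>p t - p t'\<bar> powr \<beta>"
      using p[of t] p[of t'] \<beta> by (intro powr_le_scaled) auto
    also have "\<dots> \<le> (b - a) powr (lam - \<beta>) * \<bar>t - t'\<bar> powr \<beta>"
      using \<beta> by (intro mult_left_mono p_lip) auto
    finally have "\<bar>p s - p s'\<bar> powr \<tau> * \<bar>p t - p t'\<bar> powr lam
        \<le> \<bar>s - s'\<bar> powr \<tau> * ((b - a) powr (lam - \<beta>) * \<bar>t - t'\<bar> powr \<beta>)"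
      using \<tau> by (intro mult_mono p_lip) auto
    from mult_left_mono[OF this C] show ?thesis
      using C1[OF p(1)[of s] p(1)[of s'] p(1)[of t] p(1)[of t']] by (simp add: C'_def mult_ac)
  qed
  define K where "K = S * D + S * C' + H * D"
  define W where "W = (\<lambda>s t. h (p t) * (F (p s) (p t) - F a (p t)))"
  have K: "S * D \<le> K" "0 \<le> K" using nonneg H by (auto simp: K_def)
  have W1: "\<bar>W s t - W s' t\<bar> \<le> K * \<bar>s - s'\<bar> powr \<tau>" for s s' t
  proof -
    have "\<bar>W s t - W s' t\<bar> = \<bar>h (p t)\<bar> * \<bar>F (p s) (p t) - F (p s') (p t)\<bar>"
      by (simp add: W_def abs_mult[symmetric] algebra_simps)
    also have "\<dots> \<le> S * (D * \<bar>s - s'\<bar> powr \<tau>)"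
      using nonneg by (intro mult_mono S D) auto
    also have "\<dots> \<le> K * \<bar>s - s'\<bar> powr \<tau>"
      using mult_right_mono[OF K(1), of "\<bar>s - s'\<bar> powr \<tau>"] by (simp add: mult.assoc)
    finally show ?thesis .
  qed
  have W2: "\<bar>W s t - W s' t - W s t' + W s' t'\<bar> \<le> K * \<bar>s - s'\<bar> powr \<tau> * \<bar>t - t'\<bar> powr \<beta>" for s s' t t'
  proof -
    let ?x = "\<bar>s - s'\<bar> powr \<tau> * \<bar>t - t'\<bar> powr \<beta>"
    \<comment> \<open>Discrete product rule: h weights a rectangular increment of F, and an
      increment of h multiplies a first-argument increment of F. These are the terms S * C' and H *
      D of \<open>K\<close>.\<close>
    have "W s t - W s' t - W s t' + W s' t' =
        h (p t) * (F (p s) (p t) - F (p s') (p t) - F (p s) (p t') + F (p s') (p t'))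
        + (h (p t) - h (p t')) * (F (p s) (p t') - F (p s') (p t'))"
      by (simp add: W_def algebra_simps)
    then have "\<bar>W s t - W s' t - W s t' + W s' t'\<bar> \<le>
        \<bar>h (p t)\<bar> * \<bar>F (p s) (p t) - F (p s') (p t) - F (p s) (p t') + F (p s') (p t')\<bar>
        + \<bar>h (p t) - h (p t')\<bar> * \<bar>F (p s) (p t') - F (p s') (p t')\<bar>"
      by (simp only: abs_mult[symmetric] abs_triangle_ineq)
    also have "\<dots> \<le> S * (C' * ?x) + (H * \<bar>t - t'\<bar> powr \<beta>) * (D * \<bar>s - s'\<bar> powr \<tau>)"
    proof (intro add_mono mult_mono S R D)
      have "\<bar>h (p t) - h (p t')\<bar> \<le> H * \<bar>p t - p t'\<bar> powr \<beta>" by (intro H p)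
      also have "\<dots> \<le> H * \<bar>t - t'\<bar> powr \<beta>" using H \<beta> by (intro mult_left_mono p_lip)
      finally show "\<bar>h (p t) - h (p t')\<bar> \<le> H * \<bar>t - t'\<bar> powr \<beta>" .
    qed (use nonneg H in auto)
    also have "\<dots> = (S * C' + H * D) * ?x" by (simp add: algebra_simps)
    also have "\<dots> \<le> K * ?x"
      using nonneg by (intro mult_right_mono) (auto simp: K_def)
    finally show ?thesis by (simp add: mult.assoc)
  qed
  have "W a t = 0" for t
    using p_id[of a] ab by (simp add: W_def)
  then have "(\<lambda>(s, t). W s t) \<in> borel_measurable (borel \<Otimes>\<^sub>M borel)"
    by (rule rect_holder_borel_measurable[OF W1 W2 _ \<tau> \<beta>(1)])
  then have "joint_holder W \<tau> \<beta> K"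
    using W1 W2 K \<tau> \<beta> by (intro joint_holder.intro)
  moreover have "W s t = h t * (F s t - F a t)" if "s \<in> {a..b}" "t \<in> {a..b}" for s t
    using that by (simp add: W_def p_id)
  ultimately show ?thesis by (rule that)
qed

section \<open>A single integration and the induction\<close>

text \<open>The induction step: the output satisfies the condition imposed on the weight. Additivity
  turns increments in the upper limit into integrals over short intervals, which are of order
  \<tau>.\<close>

lemma nl_integral_stage:
  assumes \<tau>: "1/2 < \<tau>" "\<tau> \<le> 1" and lam: "0 < lam" "lam \<le> 1" "\<tau> + lam > 1" and ab: "a < b"
    and rect: "rect_holder_on \<tau> lam {a..b} F" and first: "holder_on \<tau> {a..b} (\<lambda>s. F s a)"
    and h: "holder_on (min lam \<tau>) {a..b} h"
  shows "\<forall>s\<in>{a..b}. nl_integrable \<tau> lam a s h F"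
    and "holder_on (min lam \<tau>) {a..b} (\<lambda>s. nl_integral \<tau> lam a s h F)"
proof -
  let ?\<beta> = "min lam \<tau>"
  obtain W K where W: "joint_holder W \<tau> ?\<beta> K"
    and W_eq: "\<And>s t. s \<in> {a..b} \<Longrightarrow> t \<in> {a..b} \<Longrightarrow> W s t = h t * (F s t - F a t)"
    using joint_holder_clamped[OF ab _ _ _ _ rect first h] \<tau> lam by auto
  interpret joint_holder W \<tau> ?\<beta> K by (fact W)
  \<comment> \<open>Here \<tau> > 1/2 enters, through 1 - \<tau> < \<tau>; the other half, 1 -
    \<tau> < lam, is \<tau> + lam > 1.\<close>
  obtain \<alpha>0 where \<alpha>0: "1 - \<tau> < \<alpha>0" "\<alpha>0 < ?\<beta>"
    using dense[of "1 - \<tau>" ?\<beta>] \<tau> lam by auto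
  have has: "has_nl_integral \<tau> lam a s h F (if s = a then 0 else forward_integral a s)"
    if s: "s \<in> {a..b}" for s
  proof (cases "s = a")
    case False
    then have as: "a < s" using s by simp
    have "h t' * F s' t' - h t' * F s t' = W s' t' - W s t'"
      if "a \<le> s'" "s' \<le> s" "a \<le> t'" "t' \<le> s" for s' t'
      using that s by (subst (1 2) W_eq) (auto simp: algebra_simps)
    note * = frac_integral_exists_holder[of a s "\<lambda>s t. h t * F s t", OF this as]
      frac_integral_eq_kernel_mean[of a s "\<lambda>s t. h t * F s t", OF this as]
    have "frac_integral_exists \<alpha> a s (\<lambda>s t. h t * F s t) \<and>
        frac_integral \<alpha> a s (\<lambda>s t. h t * F s t) = of_real (forward_integral a s)"
      if "\<alpha> \<in> {1 - \<tau><..<?\<beta>}" for \<alpha>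
    proof -
      have \<alpha>: "0 < \<alpha>" "\<alpha> < ?\<beta>" "\<alpha> < 1" "1 - \<alpha> < \<tau>" using that \<tau> lam by auto
      show ?thesis
        using * \<alpha> forward_integral_eq_kernel_mean[OF as \<alpha>] by simp
    qed
    then show ?thesis
      using False as \<alpha>0 unfolding has_nl_integral_def by force
  qed (simp add: has_nl_integral_def)
  then show "\<forall>s\<in>{a..b}. nl_integrable \<tau> lam a s h F"
    unfolding nl_integrable_def by blast
  have val: "nl_integral \<tau> lam a s h F = (if s = a then 0 else forward_integral a s)"
    if "s \<in> {a..b}" for s
    using nl_integral_eqI[OF has[OF that]] .
  have \<alpha>: "0 < \<alpha>0" "\<alpha>0 < ?\<beta>" "\<alpha>0 < 1" "1 - \<alpha>0 < \<tau>" using \<alpha>0 \<tau> lam by auto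
  obtain M where M: "0 \<le> M" "\<And>x y. x < y \<Longrightarrow> y - x \<le> b - a \<Longrightarrow> \<bar>forward_integral x y\<bar> \<le> M * (y - x) powr \<tau>"
    using forward_integral_le[OF \<alpha>, of "b - a"] by metis
  have inc: "\<bar>nl_integral \<tau> lam a s h F - nl_integral \<tau> lam a t h F\<bar> \<le> M * \<bar>s - t\<bar> powr \<tau>"
    if st: "a \<le> s" "s < t" "t \<le> b" for s t
  proof -
    \<comment> \<open>For s = a the value there is 0 by convention and the increment is the integral
      itself; additivity is stated only for nondegenerate pieces.\<close>
    have "nl_integral \<tau> lam a t h F - nl_integral \<tau> lam a s h F = forward_integral s t"
      using st forward_integral_additive[OF _ st(2) \<alpha>, of a] by (cases "s = a") (auto simp: val)
    then show ?thesis using M(2)[of s t] st by (simp add: abs_minus_commute)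
  qed
  have "\<bar>nl_integral \<tau> lam a s h F - nl_integral \<tau> lam a t h F\<bar> \<le> M * \<bar>s - t\<bar> powr \<tau>"
    if "s \<in> {a..b}" "t \<in> {a..b}" for s t
    using that inc[of s t] inc[of t s] by (cases s t rule: linorder_cases) (auto simp: abs_minus_commute)
  then have "holder_on \<tau> {a..b} (\<lambda>s. nl_integral \<tau> lam a s h F)"
    unfolding holder_on_def by blast
  then show "holder_on ?\<beta> {a..b} (\<lambda>s. nl_integral \<tau> lam a s h F)"
    by (rule holder_on_weaken) simp
qed

theorem proposition4p2:
  fixes \<tau> lam a b :: real and n :: nat
    and \<rho> :: "real \<Rightarrow> real" and F :: "nat \<Rightarrow> real \<Rightarrow> real \<Rightarrow> real"
  assumes "0 < \<tau>" "\<tau> \<le> 1" "0 < lam" "lam \<le> 1" "\<tau> + lam > 1"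
    and "a < b" and "1 \<le> n"
    and F_rect: "\<And>i. i \<in> {1..n} \<Longrightarrow> rect_holder_on \<tau> lam {a..b} (F i)"
    and F_first: "\<And>i t. i \<in> {1..n} \<Longrightarrow> t \<in> {a..b} \<Longrightarrow> holder_on \<tau> {a..b} (\<lambda>s. F i s t)"
    and "holder_on lam {a..b} \<rho>"
    and "\<tau> > 1/2"
  shows "iterated_integral_well_defined \<tau> lam a b \<rho> F n"
proof -
  note stage = nl_integral_stage[OF \<open>\<tau> > 1/2\<close> \<open>\<tau> \<le> 1\<close> \<open>0 < lam\<close> \<open>lam \<le> 1\<close> \<open>\<tau> + lam > 1\<close> \<open>a < b\<close> F_rect F_first]
  \<comment> \<open>The restriction k \<le> n keeps the integrator \<open>F (Suc k)\<close> of each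
    step within the index range of the hypotheses. At stage 0 the order lam of \<rho> is lowered to
    \<open>min lam \<tau>\<close>.\<close>
  have holder: "holder_on (min lam \<tau>) {a..b} (iterated_stage \<tau> lam a \<rho> F k)" if "k \<le> n" for k
    using that
  proof (induction k)
    case 0
    show ?case using holder_on_weaken[OF \<open>holder_on lam {a..b} \<rho>\<close>, of "min lam \<tau>"] by simp
  next
    case (Suc k)
    then show ?case using stage(2)[of "Suc k" "iterated_stage \<tau> lam a \<rho> F k"] \<open>a < b\<close> by simp
  qed
  show ?thesis
    unfolding iterated_integral_well_defined_def
  proof (rule ballI)
    fix k assume k: "k \<in> {1..n}"
    moreover have "k - 1 \<le> n" using k by auto
    ultimately show "\<forall>s\<in>{a..b}. nl_integrable \<tau> lam a s (iterated_stage \<tau> lam a \<rho> F (k - 1)) (F k)"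
      using stage(1)[OF k k _ holder[of "k - 1"]] \<open>a < b\<close> by auto
  qed
qed

end
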